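(* Let $K$ be a field and let $G$ be an ample Hausdorff groupoid. Suppose that $G$ is minimal and effective. Then $A_K(G)$ is algebraically purely infinite simple if and only if $1_U$ is an infinite idempotent in $A_K(G)$ for every nonempty compact open $U\subseteq G^{(0)}$.
   Context: **Groupoids.** A topological groupoid $G$ has unit space $G^{(0)}$ and range and source maps $r,s:G\to G^{(0)}$. An open bisection is an open set $B\subseteq G$ such that $r$ and $s$ restrict to homeomorphisms of $B$ onto open subsets of $G^{(0)}$. $G$ is ample if it has a basis of compact open bisections. A subset $U\subseteq G^{(0)}$ is invariant if $s(\gamma)\in U\iff r(\gamma)\in U$ for all $\gamma\in G$; $G$ is minimal if the only open invariant subsets of $G^{(0)}$ are $\emptyset$ and $G^{(0)}$. $G$ is effective if for every nonempty compact open bisection $B\subseteq G\setminus G^{(0)}$ there is $\gamma\in B$ with $s(\gamma)\ne r(\gamma)$. **Steinberg algebra.** $A_K(G)$ is the $K$-algebra of locally constant, compactly supported functions $G\to K$, with pointwise addition and convolution $(f*g)(\gamma)=\sum_{\alpha\beta=\gamma}f(\alpha)g(\beta)$. $1_U$ denotes the characteristic function of $U$. **Algebraic definitions.** For idempotents $p,q$ in a ring $R$: $p\leq_{\mathrm{ring}}q$ if $pq=qp=p$; $p<_{\mathrm{ring}}q$ if moreover $p\neq q$; $p\sim_{\mathrm{ring}}q$ if there are $s,t\in R$ with $st=p$, $ts=q$. An idempotent $p$ is infinite if there is an idempotent $q$ with $p\sim_{\mathrm{ring}}q<_{\mathrm{ring}}p$. $R$ is algebraically purely infinite simple if $R$ has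 no nontrivial two-sided ideals and every nonzero right ideal contains an infinite idempotent. *)

theory Defs
  imports "HOL-Analysis.Analysis" "HOL-Algebra.AbelCoset"
begin

section \<open>Topological groupoids\<close>

text \<open>
  The set of arrows is the carrier \<open>topspace (arrows_top G)\<close>; units are arrows.  The product
  \<open>comp_map G \<alpha> \<beta>\<close> is meaningful only if \<open>source_map G \<alpha> = range_map G \<beta>\<close>.  All operations are
  unconstrained outside the arrows.
\<close>

record 'g groupoid_data =
  arrows_top :: "'g topology"
  unit_space :: "'g set"
  range_map :: "'g \<Rightarrow> 'g"
  source_map :: "'g \<Rightarrow> 'g"
  comp_map :: "'g \<Rightarrow> 'g \<Rightarrow> 'g"
  inverse_map :: "'g \<Rightarrow> 'g"

definition arrows :: "('g, 'm) groupoid_data_scheme \<Rightarrow> 'g set" where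
  "arrows G = topspace (arrows_top G)"

definition unit_top :: "('g, 'm) groupoid_data_scheme \<Rightarrow> 'g topology" where
  "unit_top G = subtopology (arrows_top G) (unit_space G)"

definition composable :: "('g, 'm) groupoid_data_scheme \<Rightarrow> ('g \<times> 'g) set" where
  "composable G = {(\<alpha>, \<beta>). \<alpha> \<in> arrows G \<and> \<beta> \<in> arrows G \<and> source_map G \<alpha> = range_map G \<beta>}"

locale topological_groupoid =
  fixes G :: "('g, 'm) groupoid_data_scheme"
  assumes units_subset: "unit_space G \<subseteq> arrows G"
    and range_in: "\<gamma> \<in> arrows G \<Longrightarrow> range_map G \<gamma> \<in> unit_space G"
    and source_in: "\<gamma> \<in> arrows G \<Longrightarrow> source_map G \<gamma> \<in> unit_space G"
    and range_unit: "u \<in> unit_space G \<Longrightarrow> range_map G u = u"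
    and source_unit: "u \<in> unit_space G \<Longrightarrow> source_map G u = u"
    and comp_in: "(\<alpha>, \<beta>) \<in> composable G \<Longrightarrow> comp_map G \<alpha> \<beta> \<in> arrows G"
    and range_comp: "(\<alpha>, \<beta>) \<in> composable G \<Longrightarrow> range_map G (comp_map G \<alpha> \<beta>) = range_map G \<alpha>"
    and source_comp: "(\<alpha>, \<beta>) \<in> composable G \<Longrightarrow> source_map G (comp_map G \<alpha> \<beta>) = source_map G \<beta>"
    and comp_assoc: "(\<alpha>, \<beta>) \<in> composable G \<Longrightarrow> (\<beta>, \<gamma>) \<in> composable G \<Longrightarrow>
      comp_map G (comp_map G \<alpha> \<beta>) \<gamma> = comp_map G \<alpha> (comp_map G \<beta> \<gamma>)"
    and range_comp_left: "\<gamma> \<in> arrows G \<Longrightarrow> comp_map G (range_map G \<gamma>) \<gamma> = \<gamma>"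
    and source_comp_right: "\<gamma> \<in> arrows G \<Longrightarrow> comp_map G \<gamma> (source_map G \<gamma>) = \<gamma>"
    and inverse_in: "\<gamma> \<in> arrows G \<Longrightarrow> inverse_map G \<gamma> \<in> arrows G"
    and range_inverse: "\<gamma> \<in> arrows G \<Longrightarrow> range_map G (inverse_map G \<gamma>) = source_map G \<gamma>"
    and source_inverse: "\<gamma> \<in> arrows G \<Longrightarrow> source_map G (inverse_map G \<gamma>) = range_map G \<gamma>"
    and comp_inverse: "\<gamma> \<in> arrows G \<Longrightarrow> comp_map G \<gamma> (inverse_map G \<gamma>) = range_map G \<gamma>"
    and inverse_comp: "\<gamma> \<in> arrows G \<Longrightarrow> comp_map G (inverse_map G \<gamma>) \<gamma> = source_map G \<gamma>"
    and continuous_comp: "continuous_map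
      (subtopology (prod_topology (arrows_top G) (arrows_top G)) (composable G))
      (arrows_top G) (\<lambda>(\<alpha>, \<beta>). comp_map G \<alpha> \<beta>)"
    and continuous_inverse: "continuous_map (arrows_top G) (arrows_top G) (inverse_map G)"

definition open_bisection :: "('g, 'm) groupoid_data_scheme \<Rightarrow> 'g set \<Rightarrow> bool" where
  "open_bisection G B \<longleftrightarrow>
    openin (arrows_top G) B \<and>
    openin (unit_top G) (range_map G ` B) \<and>
    homeomorphic_map (subtopology (arrows_top G) B)
      (subtopology (unit_top G) (range_map G ` B)) (range_map G) \<and>
    openin (unit_top G) (source_map G ` B) \<and>
    homeomorphic_map (subtopology (arrows_top G) B)
      (subtopology (unit_top G) (source_map G ` B)) (source_map G)"

definition compact_open_bisection :: "('g, 'm) groupoid_data_scheme \<Rightarrow> 'g set \<Rightarrow> bool" where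
  "compact_open_bisection G B \<longleftrightarrow> open_bisection G B \<and> compactin (arrows_top G) B"

locale ample_groupoid = topological_groupoid G
  for G :: "('g, 'm) groupoid_data_scheme" +
  assumes ample: "openin (arrows_top G) W \<Longrightarrow> \<gamma> \<in> W \<Longrightarrow>
    \<exists>B. compact_open_bisection G B \<and> \<gamma> \<in> B \<and> B \<subseteq> W"

locale ample_Hausdorff_groupoid = ample_groupoid G
  for G :: "('g, 'm) groupoid_data_scheme" +
  assumes Hausdorff: "Hausdorff_space (arrows_top G)"

definition invariant_units :: "('g, 'm) groupoid_data_scheme \<Rightarrow> 'g set \<Rightarrow> bool" where
  "invariant_units G U \<longleftrightarrow> U \<subseteq> unit_space G \<and>
    (\<forall>\<gamma>\<in>arrows G. source_map G \<gamma> \<in> U \<longleftrightarrow> range_map G \<gamma> \<in> U)"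

definition minimal_groupoid :: "('g, 'm) groupoid_data_scheme \<Rightarrow> bool" where
  "minimal_groupoid G \<longleftrightarrow>
    (\<forall>U. openin (unit_top G) U \<and> invariant_units G U \<longrightarrow> U = {} \<or> U = unit_space G)"

definition effective_groupoid :: "('g, 'm) groupoid_data_scheme \<Rightarrow> bool" where
  "effective_groupoid G \<longleftrightarrow>
    (\<forall>B. compact_open_bisection G B \<and> B \<noteq> {} \<and> B \<subseteq> arrows G - unit_space G \<longrightarrow>
      (\<exists>\<gamma>\<in>B. source_map G \<gamma> \<noteq> range_map G \<gamma>))"

section \<open>Steinberg algebras\<close>

definition locally_constant_on :: "'g topology \<Rightarrow> ('g \<Rightarrow> 'k) \<Rightarrow> bool" where
  "locally_constant_on X f \<longleftrightarrow>
    (\<forall>x\<in>topspace X. \<exists>V. openin X V \<and> x \<in> V \<and> (\<forall>y\<in>V. f y = f x))"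

definition compactly_supported_on :: "'g topology \<Rightarrow> ('g \<Rightarrow> 'k::zero) \<Rightarrow> bool" where
  "compactly_supported_on X f \<longleftrightarrow> compactin X (X closure_of {x \<in> topspace X. f x \<noteq> 0})"

text \<open>
  The sum is restricted to the nonzero terms because \<^const>\<open>sum\<close> vanishes on infinite index sets;
  there are finitely many such terms if \<open>f\<close> and \<open>g\<close> lie in the Steinberg algebra of an ample
  Hausdorff groupoid.
\<close>

definition convolution ::
  "('g, 'm) groupoid_data_scheme \<Rightarrow> ('g \<Rightarrow> 'k::field) \<Rightarrow> ('g \<Rightarrow> 'k) \<Rightarrow> 'g \<Rightarrow> 'k" where
  "convolution G f g \<gamma> =
    (\<Sum>(\<alpha>, \<beta>) \<in> {(\<alpha>, \<beta>). (\<alpha>, \<beta>) \<in> composable G \<and> comp_map G \<alpha> \<beta> = \<gamma> \<and> f \<alpha> \<noteq> 0 \<and> g \<beta> \<noteq> 0}.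
      f \<alpha> * g \<beta>)"

text \<open>
  A function on the arrows is represented by its extension by zero to the whole type.
  The ring need not be unital: the field \<open>one\<close> of the record is the only candidate for an identity
  and lies in the carrier just when the unit space is compact.  No definition below refers to it.
  Scalar multiplication is omitted, as only the ring structure matters.
\<close>

definition steinberg_algebra ::
  "('g, 'm) groupoid_data_scheme \<Rightarrow> ('g \<Rightarrow> 'k::field) ring" where
  "steinberg_algebra G =
    \<lparr>carrier = {f. locally_constant_on (arrows_top G) f \<and>
                  compactly_supported_on (arrows_top G) f \<and> (\<forall>x. x \<notin> arrows G \<longrightarrow> f x = 0)},
     mult = convolution G,
     one = indicator (unit_space G),
     zero = (\<lambda>_. 0),
     add = (\<lambda>f g x. f x + g x)\<rparr>"

section \<open>Purely infinite simple rings\<close>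

text \<open>
  These notions are meant for rings without identity.  The library locale \<^locale>\<open>ring\<close>, and
  hence its notion of ideal, requires one.
\<close>

definition right_ideal :: "'a set \<Rightarrow> ('a, 'm) ring_scheme \<Rightarrow> bool" where
  "right_ideal I R \<longleftrightarrow> additive_subgroup I R \<and> (\<forall>x\<in>I. \<forall>a\<in>carrier R. x \<otimes>\<^bsub>R\<^esub> a \<in> I)"

definition two_sided_ideal :: "'a set \<Rightarrow> ('a, 'm) ring_scheme \<Rightarrow> bool" where
  "two_sided_ideal I R \<longleftrightarrow> additive_subgroup I R \<and>
    (\<forall>x\<in>I. \<forall>a\<in>carrier R. a \<otimes>\<^bsub>R\<^esub> x \<in> I \<and> x \<otimes>\<^bsub>R\<^esub> a \<in> I)"

definition idempotent :: "('a, 'm) ring_scheme \<Rightarrow> 'a \<Rightarrow> bool" where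
  "idempotent R p \<longleftrightarrow> p \<in> carrier R \<and> p \<otimes>\<^bsub>R\<^esub> p = p"

definition idem_le :: "('a, 'm) ring_scheme \<Rightarrow> 'a \<Rightarrow> 'a \<Rightarrow> bool" where
  "idem_le R p q \<longleftrightarrow> p \<otimes>\<^bsub>R\<^esub> q = p \<and> q \<otimes>\<^bsub>R\<^esub> p = p"

definition idem_less :: "('a, 'm) ring_scheme \<Rightarrow> 'a \<Rightarrow> 'a \<Rightarrow> bool" where
  "idem_less R p q \<longleftrightarrow> idem_le R p q \<and> p \<noteq> q"

definition idem_equiv :: "('a, 'm) ring_scheme \<Rightarrow> 'a \<Rightarrow> 'a \<Rightarrow> bool" where
  "idem_equiv R p q \<longleftrightarrow> (\<exists>s\<in>carrier R. \<exists>t\<in>carrier R. s \<otimes>\<^bsub>R\<^esub> t = p \<and> t \<otimes>\<^bsub>R\<^esub> s = q)"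

definition infinite_idempotent :: "('a, 'm) ring_scheme \<Rightarrow> 'a \<Rightarrow> bool" where
  "infinite_idempotent R p \<longleftrightarrow> idempotent R p \<and>
    (\<exists>q. idempotent R q \<and> idem_equiv R p q \<and> idem_less R q p)"

definition algebraically_purely_infinite_simple :: "('a, 'm) ring_scheme \<Rightarrow> bool" where
  "algebraically_purely_infinite_simple R \<longleftrightarrow>
    (\<forall>I. two_sided_ideal I R \<longrightarrow> I = {\<zero>\<^bsub>R\<^esub>} \<or> I = carrier R) \<and>
    (\<forall>I. right_ideal I R \<and> I \<noteq> {\<zero>\<^bsub>R\<^esub>} \<longrightarrow> (\<exists>p\<in>I. infinite_idempotent R p))"

end

(*
  Effectiveness and the Hausdorff property make every nonzero a in the Steinberg algebra dominate an
  indicator: x a y = 1_V for some x, y and some nonempty compact open set V of units.  If 1_V is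
  infinite, then a y 1_V x is an equivalent idempotent in the right ideal generated by a.  If 1_V lies in
  a two-sided ideal, then conjugation by bisections and minimality put the indicators of arbitrarily
  large compact open unit sets into the ideal, and these are local units.  Conversely, an infinite
  idempotent in the right ideal of all f with 1_U f = f yields one below 1_U, which forces 1_U to be
  infinite.
*)

theory Submission
  imports Defs
begin

section \<open>Infinite idempotents in rings without identity\<close>

text \<open>Three obstacles shape the argument. The algebra may lack an identity, so infiniteness of
  an idempotent e is handled through a pair s, t in the corner eRe with st = e and ts different from
  e. Membership in a right ideal controls an idempotent on one side only, so p has to be corrected
  to pe before it can be compared with e. Finally, cutting \<open>a\<close> down to an indicator
  means discarding the part of its support away from the units. Units are open in an ample groupoid,
  so that part of a compact support is compact. Hausdorffness makes the units closed, so the same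
  part is covered by finitely many compact open bisections free of units, and effectiveness treats
  these one at a time, shrinking a set of units at each step. On the surviving set the function has
  a single nonzero value c, which is invertible because K is a field.\<close>

locale nonunital_ring = abelian_group R for R (structure) +
  assumes m_closed [intro, simp]: "\<lbrakk>x \<in> carrier R; y \<in> carrier R\<rbrakk> \<Longrightarrow> x \<otimes> y \<in> carrier R"
    and m_assoc: "\<lbrakk>x \<in> carrier R; y \<in> carrier R; z \<in> carrier R\<rbrakk> \<Longrightarrow> (x \<otimes> y) \<otimes> z = x \<otimes> (y \<otimes> z)"
    and l_distr: "\<lbrakk>x \<in> carrier R; y \<in> carrier R; z \<in> carrier R\<rbrakk> \<Longrightarrow> (x \<oplus> y) \<otimes> z = x \<otimes> z \<oplus> y \<otimes> z"
    and r_distr: "\<lbrakk>x \<in> carrier R; y \<in> carrier R; z \<in> carrier R\<rbrakk> \<Longrightarrow> z \<otimes> (x \<oplus> y) = z \<otimes> x \<oplus> z \<otimes> y"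
begin

lemma m_zero_right [simp]: "x \<in> carrier R \<Longrightarrow> x \<otimes> \<zero> = \<zero>"
  using r_distr[of \<zero> \<zero> x] by (metis add.l_cancel_one m_closed r_zero zero_closed)

lemma m_zero_left [simp]: "x \<in> carrier R \<Longrightarrow> \<zero> \<otimes> x = \<zero>"
  using l_distr[of \<zero> \<zero> x] by (metis add.l_cancel_one m_closed r_zero zero_closed)

lemma m_minus_right: "\<lbrakk>x \<in> carrier R; y \<in> carrier R\<rbrakk> \<Longrightarrow> x \<otimes> (\<ominus> y) = \<ominus> (x \<otimes> y)"
  using r_distr[of "\<ominus> y" y x] by (metis a_inv_closed l_neg m_closed m_zero_right minus_equality)

lemma m_minus_left: "\<lbrakk>x \<in> carrier R; y \<in> carrier R\<rbrakk> \<Longrightarrow> (\<ominus> x) \<otimes> y = \<ominus> (x \<otimes> y)"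
  using l_distr[of "\<ominus> x" x y] by (metis a_inv_closed l_neg m_closed m_zero_left minus_equality)

text \<open>The smaller idempotent is ts: it is idempotent because (ts)(ts) = t(st)s = tes = ts, and
  it lies below e because s and t live in the corner eRe.\<close>

lemma infinite_idempotentI:
  assumes "idempotent R e" "s \<in> carrier R" "t \<in> carrier R"
    and "e \<otimes> s = s" "s \<otimes> e = s" "e \<otimes> t = t" "t \<otimes> e = t" "s \<otimes> t = e" "t \<otimes> s \<noteq> e"
  shows "infinite_idempotent R e"
proof -
  have e: "e \<in> carrier R" using assms(1) by (simp add: idempotent_def)
  have "(t \<otimes> s) \<otimes> (t \<otimes> s) = t \<otimes> ((s \<otimes> t) \<otimes> s)"
    using assms(2,3) by (simp add: m_assoc)
  then have "idempotent R (t \<otimes> s)" using assms by (simp add: idempotent_def)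
  moreover have "idem_less R (t \<otimes> s) e"
    using assms e by (simp add: idem_less_def idem_le_def m_assoc flip: m_assoc[of e])
  moreover have "idem_equiv R e (t \<otimes> s)" using assms by (auto simp: idem_equiv_def)
  ultimately show ?thesis using assms(1) by (auto simp: infinite_idempotent_def)
qed

text \<open>The definition places the two partial isometries anywhere in the ring. Replacing s by
  psq and t by qtp keeps both products, and q lying below p puts the new pair into the corner
  pRp.\<close>

lemma infinite_idempotentE:
  assumes "infinite_idempotent R p"
  obtains a b where "idempotent R p" "a \<in> carrier R" "b \<in> carrier R"
    "p \<otimes> a = a" "a \<otimes> p = a" "p \<otimes> b = b" "b \<otimes> p = b" "a \<otimes> b = p" "b \<otimes> a \<noteq> p"
    "p \<otimes> (b \<otimes> a) = b \<otimes> a" "(b \<otimes> a) \<otimes> p = b \<otimes> a"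
proof -
  from assms obtain q s t where
    p: "p \<in> carrier R" "p \<otimes> p = p" and q: "q \<in> carrier R" "q \<otimes> q = q"
    and st: "s \<in> carrier R" "t \<in> carrier R" "s \<otimes> t = p" "t \<otimes> s = q"
    and qp: "q \<otimes> p = q" "p \<otimes> q = q" "q \<noteq> p"
    by (auto simp: infinite_idempotent_def idempotent_def idem_equiv_def idem_less_def idem_le_def)
  define a b where "a = p \<otimes> s \<otimes> q" and "b = q \<otimes> t \<otimes> p"
  have c: "a \<in> carrier R" "b \<in> carrier R" using p q st by (auto simp: a_def b_def)
  have ts: "t \<otimes> (s \<otimes> z) = q \<otimes> z" "s \<otimes> (t \<otimes> z) = p \<otimes> z"
    "p \<otimes> (p \<otimes> z) = p \<otimes> z" "q \<otimes> (q \<otimes> z) = q \<otimes> z" "p \<otimes> (q \<otimes> z) = q \<otimes> z"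
    "q \<otimes> (p \<otimes> z) = q \<otimes> z" if "z \<in> carrier R" for z
    using that st p q qp by (simp_all flip: m_assoc)
  \<comment> \<open>Both sides of the first equation are sts, both sides of the second tst.\<close>
  have sq: "s \<otimes> q = p \<otimes> s" "t \<otimes> p = q \<otimes> t"
    using st m_assoc by metis+
  have "s \<otimes> (q \<otimes> z) = p \<otimes> (s \<otimes> z)" "t \<otimes> (p \<otimes> z) = q \<otimes> (t \<otimes> z)" if "z \<in> carrier R" for z
    using that st p q sq by (simp_all flip: m_assoc)
  note rules = this sq ts m_assoc a_def b_def
  have ab: "a \<otimes> b = p" "b \<otimes> a = q" using p q st qp by (simp_all add: rules)
  have "p \<otimes> a = a" "a \<otimes> p = a" "p \<otimes> b = b" "b \<otimes> p = b"
    unfolding a_def b_def using p q st qp by (simp_all add: m_assoc ts)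
  then show thesis
    using that[of a b] c ab p qp by (simp add: idempotent_def)
qed

text \<open>Since ts = e, the map z to szt is multiplicative on eRe and carries e to p, so it
  transports a witnessing pair. The map z to tzs undoes it, which is why the transported pair cannot
  multiply to p in the reverse order.\<close>

lemma infinite_idempotent_equiv:
  assumes "infinite_idempotent R e" "idempotent R p"
    and st: "s \<in> carrier R" "t \<in> carrier R" "s \<otimes> t = p" "t \<otimes> s = e"
  shows "infinite_idempotent R p"
proof -
  obtain a b where ab: "idempotent R e" "a \<in> carrier R" "b \<in> carrier R"
    "e \<otimes> a = a" "a \<otimes> e = a" "e \<otimes> b = b" "b \<otimes> e = b" "a \<otimes> b = e" "b \<otimes> a \<noteq> e"
    using infinite_idempotentE[OF assms(1)] by metis
  then have e: "e \<in> carrier R" "e \<otimes> e = e" by (auto simp: idempotent_def)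
  have p: "p \<in> carrier R" "p \<otimes> p = p" using assms(2) by (auto simp: idempotent_def)
  have rules: "t \<otimes> (s \<otimes> z) = e \<otimes> z" "s \<otimes> (t \<otimes> z) = p \<otimes> z"
    "e \<otimes> (a \<otimes> z) = a \<otimes> z" "e \<otimes> (b \<otimes> z) = b \<otimes> z" "a \<otimes> (b \<otimes> z) = e \<otimes> z"
    "a \<otimes> (e \<otimes> z) = a \<otimes> z" "b \<otimes> (e \<otimes> z) = b \<otimes> z" if "z \<in> carrier R" for z
    using that st ab e by (simp_all flip: m_assoc)
  have set: "e \<otimes> t = t \<otimes> p" "s \<otimes> e = p \<otimes> s" using st m_assoc by metis+
  have sp: "p \<otimes> (s \<otimes> z) = s \<otimes> (e \<otimes> z)" if "z \<in> carrier R" for z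
    using that st e p set by (simp flip: m_assoc)
  show ?thesis
  proof (rule infinite_idempotentI)
    let ?a = "s \<otimes> (a \<otimes> t)" and ?b = "s \<otimes> (b \<otimes> t)"
    show "idempotent R p" "?a \<in> carrier R" "?b \<in> carrier R" using assms(2) st ab by auto
    show "p \<otimes> ?a = ?a" "p \<otimes> ?b = ?b" using st ab by (simp_all add: sp rules)
    have "a \<otimes> (t \<otimes> p) = a \<otimes> t" "b \<otimes> (t \<otimes> p) = b \<otimes> t"
      using st ab e by (simp_all add: rules flip: set)
    then show "?a \<otimes> p = ?a" "?b \<otimes> p = ?b" using st ab p by (simp_all add: m_assoc)
    have "s \<otimes> (e \<otimes> t) = p" using st p by (simp add: set) (metis m_assoc)
    then show "?a \<otimes> ?b = p" using st ab p e by (simp add: m_assoc rules)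
    show "?b \<otimes> ?a \<noteq> p"
    proof
      assume "?b \<otimes> ?a = p"
      then have "t \<otimes> (?b \<otimes> ?a) \<otimes> s = t \<otimes> p \<otimes> s" by simp
      then show False using st ab e p by (simp add: m_assoc rules flip: set)
    qed
  qed
qed

lemma right_ideal_infinite_idempotent:
  assumes "right_ideal I R" "a \<in> I" "x \<in> carrier R" "y \<in> carrier R"
    and inf: "infinite_idempotent R (x \<otimes> a \<otimes> y)"
  shows "\<exists>p\<in>I. infinite_idempotent R p"
proof -
  define e where "e = x \<otimes> a \<otimes> y"
  have a: "a \<in> carrier R"
    using assms(1,2) additive_subgroup.a_subset unfolding right_ideal_def by blast
  have e: "e \<in> carrier R" "e \<otimes> e = e"
    using inf by (auto simp: e_def infinite_idempotent_def idempotent_def)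
  \<comment> \<open>Without the cut by e, the square of ayx would be ayex, which need not be ayx.
    The cut gives eu = u, and this makes avu idempotent.\<close>
  define u v where "u = e \<otimes> x" and "v = y \<otimes> e"
  have uv: "u \<in> carrier R" "v \<in> carrier R" using e assms by (auto simp: u_def v_def)
  have eu: "e \<otimes> u = u" using e assms by (simp add: u_def flip: m_assoc)
  have "u \<otimes> (a \<otimes> v) = e \<otimes> (x \<otimes> a \<otimes> y) \<otimes> e"
    using e assms a by (simp add: u_def v_def m_assoc)
  then have uav: "u \<otimes> (a \<otimes> v) = e" using e by (simp flip: e_def)
  let ?p = "(a \<otimes> v) \<otimes> u"
  have "?p \<otimes> ?p = (a \<otimes> v) \<otimes> ((u \<otimes> (a \<otimes> v)) \<otimes> u)"
    using uv a by (simp add: m_assoc)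
  then have "idempotent R ?p" using uv a eu by (simp add: uav idempotent_def)
  then have "infinite_idempotent R ?p"
    using inf[folded e_def] uv a uav infinite_idempotent_equiv by blast
  moreover have "?p \<in> I" using assms(1,2) uv by (auto simp: right_ideal_def)
  ultimately show ?thesis by blast
qed

text \<open>For idempotent e this is eR. Written as a set of fixed points it hands over ep = p for
  each member p, which is the form that \<open>infinite_idempotent_above\<close> takes as
  hypothesis.\<close>

lemma right_ideal_fixed_by_idempotent:
  assumes e: "e \<in> carrier R"
  shows "right_ideal {x \<in> carrier R. e \<otimes> x = x} R"
proof -
  have "subgroup {x \<in> carrier R. e \<otimes> x = x} (add_monoid R)"
    by (rule add.subgroupI)
      (use e zero_closed in \<open>auto simp: r_distr m_minus_right simp flip: a_inv_def\<close>)
  then show ?thesis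
    using e by (auto simp: right_ideal_def additive_subgroup_def simp flip: m_assoc)
qed

text \<open>
  An infinite idempotent \<open>p\<close> with \<open>e p = p\<close> need not lie below \<open>e\<close>, but \<open>p e\<close> does and is
  equivalent to \<open>p\<close>; adding \<open>e - p e\<close> to the partial isometries that witness that
  \<open>p e\<close> is infinite gives such witnesses for \<open>e\<close>.
\<close>

lemma infinite_idempotent_above:
  assumes "idempotent R e" "infinite_idempotent R p" "e \<otimes> p = p"
  shows "infinite_idempotent R e"
proof -
  obtain a b where ab: "idempotent R p" "a \<in> carrier R" "b \<in> carrier R"
    "p \<otimes> a = a" "a \<otimes> p = a" "p \<otimes> b = b" "b \<otimes> p = b" "a \<otimes> b = p" "b \<otimes> a \<noteq> p"
    "p \<otimes> (b \<otimes> a) = b \<otimes> a" "(b \<otimes> a) \<otimes> p = b \<otimes> a"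
    using infinite_idempotentE[OF assms(2)] by metis
  have p: "p \<in> carrier R" "p \<otimes> p = p" using ab(1) by (auto simp: idempotent_def)
  have e: "e \<in> carrier R" "e \<otimes> e = e" using assms(1) by (auto simp: idempotent_def)
  have ea: "e \<otimes> a = a" "e \<otimes> b = b" using ab e p assms(3) m_assoc by metis+
  have rules: "e \<otimes> (a \<otimes> z) = a \<otimes> z" "e \<otimes> (b \<otimes> z) = b \<otimes> z" "e \<otimes> (p \<otimes> z) = p \<otimes> z"
    "p \<otimes> (a \<otimes> z) = a \<otimes> z" "p \<otimes> (b \<otimes> z) = b \<otimes> z" "p \<otimes> (p \<otimes> z) = p \<otimes> z" "e \<otimes> (e \<otimes> z) = e \<otimes> z"
    "a \<otimes> (p \<otimes> z) = a \<otimes> z" "b \<otimes> (p \<otimes> z) = b \<otimes> z" "a \<otimes> (b \<otimes> z) = p \<otimes> z" if "z \<in> carrier R" for z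
    using that ab e p ea assms(3) by (simp_all flip: m_assoc)
  \<comment> \<open>d is the complement of pe in the corner eRe. It annihilates
    \<open>a \<otimes> e\<close> and \<open>b \<otimes> e\<close> from both sides, so sums of the
    form xe + d multiply componentwise.\<close>
  define d where "d = e \<oplus> \<ominus> (p \<otimes> e)"
  have d: "d \<in> carrier R" using e p by (simp add: d_def)
  have dd: "d \<otimes> (a \<otimes> e) = \<zero>" "d \<otimes> (b \<otimes> e) = \<zero>" "(a \<otimes> e) \<otimes> d = \<zero>" "(b \<otimes> e) \<otimes> d = \<zero>"
    "e \<otimes> d = d" "d \<otimes> e = d" "d \<otimes> (p \<otimes> e) = \<zero>"
    using ab e p by (simp_all add: d_def l_distr r_distr m_minus_left m_minus_right m_assoc rules r_neg)
  have "d \<otimes> d = d \<otimes> e \<oplus> \<ominus> (d \<otimes> (p \<otimes> e))"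
    using d e p by (subst (2) d_def) (simp add: r_distr m_minus_right)
  then have d2: "d \<otimes> d = d" using d dd by simp
  have prod: "(x \<otimes> e \<oplus> d) \<otimes> (y \<otimes> e \<oplus> d) = (x \<otimes> y) \<otimes> e \<oplus> d"
    if "x \<in> {a, b}" "y \<in> {a, b}" for x y
  proof -
    have xy: "x \<in> carrier R" "y \<in> carrier R" using that ab by auto
    have "(x \<otimes> e \<oplus> d) \<otimes> (y \<otimes> e \<oplus> d)
        = ((x \<otimes> e) \<otimes> (y \<otimes> e) \<oplus> (x \<otimes> e) \<otimes> d) \<oplus> (d \<otimes> (y \<otimes> e) \<oplus> d \<otimes> d)"
      using xy e d by (simp add: l_distr r_distr a_ac)
    also have "\<dots> = (x \<otimes> e) \<otimes> (y \<otimes> e) \<oplus> d" using that xy e d dd d2 by auto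
    also have "(x \<otimes> e) \<otimes> (y \<otimes> e) = (x \<otimes> y) \<otimes> e"
    proof -
      have "e \<otimes> (y \<otimes> e) = y \<otimes> e" using that e rules by auto
      then show ?thesis using xy e by (simp add: m_assoc)
    qed
    finally show ?thesis .
  qed
  show ?thesis
  proof (rule infinite_idempotentI)
    let ?s = "a \<otimes> e \<oplus> d" and ?t = "b \<otimes> e \<oplus> d"
    show "idempotent R e" "?s \<in> carrier R" "?t \<in> carrier R" using assms(1) ab e d by auto
    show "e \<otimes> ?s = ?s" "?s \<otimes> e = ?s" "e \<otimes> ?t = ?t" "?t \<otimes> e = ?t"
      using ab e d dd by (simp_all add: l_distr r_distr m_assoc rules)
    show "?s \<otimes> ?t = e"
      using ab e p by (simp add: prod) (simp add: d_def a_lcomm r_neg)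
    show "?t \<otimes> ?s \<noteq> e"
    proof
      assume "?t \<otimes> ?s = e"
      then have *: "(b \<otimes> a) \<otimes> e \<oplus> d = e" by (simp add: prod)
      \<comment> \<open>Right multiplication by p kills d, because dp = ep - pep = p - p, and leaves
        ba on the left and p on the right.\<close>
      have "((b \<otimes> a) \<otimes> e \<oplus> d) \<otimes> p = e \<otimes> p" using * by simp
      moreover have "d \<otimes> p = \<zero>"
        using e p assms(3) by (simp add: d_def l_distr m_minus_left m_assoc r_neg)
      ultimately have "b \<otimes> a = p"
        using ab e p d assms(3) by (simp add: l_distr m_assoc)
      then show False using ab by simp
    qed
  qed
qed

end

section \<open>Ample groupoids\<close>

context topological_groupoid
begin

abbreviation "T \<equiv> arrows_top G"
abbreviation "rng \<equiv> range_map G"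
abbreviation "src \<equiv> source_map G"
abbreviation "iv \<equiv> inverse_map G"
abbreviation comp (infixl "\<cdot>" 70) where "\<alpha> \<cdot> \<beta> \<equiv> comp_map G \<alpha> \<beta>"

section \<open>Algebraic identities in a groupoid\<close>

lemma unit_in_arrows: "u \<in> unit_space G \<Longrightarrow> u \<in> arrows G"
  using units_subset by blast

lemmas groupoid_simps [simp] = range_in source_in range_unit source_unit range_comp_left
  source_comp_right inverse_in range_inverse source_inverse comp_inverse inverse_comp

lemma range_source_arrows [simp]:
  assumes "\<gamma> \<in> arrows G"
  shows "rng \<gamma> \<in> arrows G" "src \<gamma> \<in> arrows G"
  by (rule unit_in_arrows[OF range_in[OF assms]], rule unit_in_arrows[OF source_in[OF assms]])

lemma composable_iff [simp]:
  "(\<alpha>, \<beta>) \<in> composable G \<longleftrightarrow> \<alpha> \<in> arrows G \<and> \<beta> \<in> arrows G \<and> src \<alpha> = rng \<beta>"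
  by (auto simp: composable_def)

lemma comp_simps [simp]:
  assumes "\<alpha> \<in> arrows G" "\<beta> \<in> arrows G" "src \<alpha> = rng \<beta>"
  shows "\<alpha> \<cdot> \<beta> \<in> arrows G" "rng (\<alpha> \<cdot> \<beta>) = rng \<alpha>" "src (\<alpha> \<cdot> \<beta>) = src \<beta>"
  using assms comp_in range_comp source_comp by auto

lemma assoc:
  assumes "\<alpha> \<in> arrows G" "\<beta> \<in> arrows G" "\<gamma> \<in> arrows G" "src \<alpha> = rng \<beta>" "src \<beta> = rng \<gamma>"
  shows "(\<alpha> \<cdot> \<beta>) \<cdot> \<gamma> = \<alpha> \<cdot> (\<beta> \<cdot> \<gamma>)"
  using assms comp_assoc by auto

lemma cancel [simp]:
  assumes "\<alpha> \<in> arrows G" "\<beta> \<in> arrows G"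
  shows "src \<alpha> = rng \<beta> \<Longrightarrow> iv \<alpha> \<cdot> (\<alpha> \<cdot> \<beta>) = \<beta>"
    and "rng \<alpha> = rng \<beta> \<Longrightarrow> \<alpha> \<cdot> (iv \<alpha> \<cdot> \<beta>) = \<beta>"
    and "src \<alpha> = rng \<beta> \<Longrightarrow> (\<alpha> \<cdot> \<beta>) \<cdot> iv \<beta> = \<alpha>"
    and "src \<alpha> = src \<beta> \<Longrightarrow> (\<alpha> \<cdot> iv \<beta>) \<cdot> \<beta> = \<alpha>"
  using assms by (simp_all flip: assoc[of "iv \<alpha>" \<alpha>] assoc[of \<alpha> "iv \<alpha>"])
    (simp_all add: assoc, (metis source_comp_right)+)

lemma inverse_inverse [simp]: "\<gamma> \<in> arrows G \<Longrightarrow> iv (iv \<gamma>) = \<gamma>"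
  using cancel(1)[of "iv \<gamma>" \<gamma>] by (metis inverse_comp inverse_in range_inverse source_comp_right
      source_inverse)

lemma inverse_unit [simp]: "u \<in> unit_space G \<Longrightarrow> iv u = u"
  by (metis comp_inverse inverse_in range_comp_left range_inverse range_unit source_unit
      unit_in_arrows)

section \<open>Continuity of the structure maps\<close>

lemma topspace_arrows [simp]: "topspace T = arrows G"
  by (simp add: arrows_def)

lemma openin_arrows [simp]: "openin T (arrows G)"
  using openin_topspace[of T] by simp

lemma continuous_comp_maps:
  assumes "continuous_map Y T f" "continuous_map Y T g"
    and "\<And>y. y \<in> topspace Y \<Longrightarrow> src (f y) = rng (g y)"
  shows "continuous_map Y T (\<lambda>y. f y \<cdot> g y)"
proof -
  have "f y \<in> arrows G" "g y \<in> arrows G" if "y \<in> topspace Y" for y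
    using assms that by (auto simp: continuous_map_def)
  then have "continuous_map Y (subtopology (prod_topology T T) (composable G)) (\<lambda>y. (f y, g y))"
    using assms by (intro continuous_map_into_subtopology continuous_map_pairedI) auto
  from continuous_map_compose[OF this continuous_comp] show ?thesis by (simp add: o_def)
qed

text \<open>Continuity of range and source is derived: they are
  \<open>\<gamma> \<cdot> iv \<gamma>\<close> and \<open>iv \<gamma> \<cdot> \<gamma>\<close>, hence
  composed of the two operations whose continuity is an axiom.\<close>

lemma continuous_range: "continuous_map T T rng"
  by (rule continuous_map_eq[OF continuous_comp_maps[OF continuous_map_id continuous_inverse]]) auto

lemma continuous_source: "continuous_map T T src"
  by (rule continuous_map_eq[OF continuous_comp_maps[OF continuous_inverse continuous_map_id]]) auto

lemma openin_range_vimage: "openin T U \<Longrightarrow> openin T {\<gamma> \<in> arrows G. rng \<gamma> \<in> U}"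
  using openin_continuous_map_preimage[OF continuous_range] by simp

lemma openin_source_vimage: "openin T U \<Longrightarrow> openin T {\<gamma> \<in> arrows G. src \<gamma> \<in> U}"
  using openin_continuous_map_preimage[OF continuous_source] by simp

text \<open>Inversion is an involution, so images are preimages, and continuity turns this into
  openness of images.\<close>

lemma inverse_image_eq:
  assumes "B \<subseteq> arrows G"
  shows "iv ` B = {\<gamma> \<in> arrows G. iv \<gamma> \<in> B}"
proof (intro equalityI subsetI)
  fix \<gamma> assume "\<gamma> \<in> {\<gamma> \<in> arrows G. iv \<gamma> \<in> B}"
  then show "\<gamma> \<in> iv ` B" by (intro image_eqI[of _ _ "iv \<gamma>"]) simp_all
next
  fix \<gamma> assume "\<gamma> \<in> iv ` B"
  then show "\<gamma> \<in> {\<gamma> \<in> arrows G. iv \<gamma> \<in> B}" using assms by auto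
qed

lemma openin_inverse_image: "openin T B \<Longrightarrow> openin T (iv ` B)"
  using openin_continuous_map_preimage[OF continuous_inverse, of B] openin_subset[of T B]
  by (simp add: inverse_image_eq)

lemma compactin_inverse_image: "compactin T B \<Longrightarrow> compactin T (iv ` B)"
  by (rule image_compactin[OF _ continuous_inverse])

section \<open>Bisections\<close>

lemma bisection_openin: "open_bisection G B \<Longrightarrow> openin T B"
  by (simp add: open_bisection_def)

lemma bisection_subset: "open_bisection G B \<Longrightarrow> B \<subseteq> arrows G"
  using bisection_openin openin_subset by fastforce

lemma bisection_inj_range:
  assumes "open_bisection G B"
  shows "inj_on rng B"
proof -
  have "inj_on rng (topspace (subtopology T B))"
    using assms unfolding open_bisection_def by (metis homeomorphic_imp_injective_map)
  then show ?thesis using bisection_subset[OF assms] by (simp add: inf.absorb2)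
qed

lemma bisection_inj_source:
  assumes "open_bisection G B"
  shows "inj_on src B"
proof -
  have "inj_on src (topspace (subtopology T B))"
    using assms unfolding open_bisection_def by (metis homeomorphic_imp_injective_map)
  then show ?thesis using bisection_subset[OF assms] by (simp add: inf.absorb2)
qed

end

context ample_groupoid
begin

lemma cob_bisection: "compact_open_bisection G B \<Longrightarrow> open_bisection G B"
  by (simp add: compact_open_bisection_def)

lemma cob_compact: "compact_open_bisection G B \<Longrightarrow> compactin T B"
  by (simp add: compact_open_bisection_def)

lemmas cob_openin = bisection_openin[OF cob_bisection]
  and cob_subset = bisection_subset[OF cob_bisection]
  and cob_inj_range = bisection_inj_range[OF cob_bisection]
  and cob_inj_source = bisection_inj_source[OF cob_bisection]

text \<open>
  Near a unit \<open>u\<close>, an open bisection \<open>B\<close> containing \<open>u\<close> is made of units: an arrow \<open>\<gamma> \<in> B\<close> whose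
  range again lies in \<open>B\<close> has the same range as \<open>rng \<gamma>\<close>.
\<close>

lemma openin_units: "openin T (unit_space G)"
proof (subst openin_subopen, intro ballI)
  fix u assume u: "u \<in> unit_space G"
  then obtain B where B: "compact_open_bisection G B" "u \<in> B"
    using ample[of "topspace T" u] unit_in_arrows by auto
  let ?V = "B \<inter> {\<gamma> \<in> arrows G. rng \<gamma> \<in> B}"
  have "openin T ?V" using cob_openin[OF B(1)] openin_range_vimage by blast
  moreover have "\<gamma> \<in> unit_space G" if "\<gamma> \<in> ?V" for \<gamma>
  proof -
    have "rng \<gamma> = \<gamma>" using inj_onD[OF cob_inj_range[OF B(1)], of "rng \<gamma>" \<gamma>] that by simp
    then show ?thesis using that range_in[of \<gamma>] by simp
  qed
  moreover have "u \<in> ?V" using B u unit_in_arrows by simp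
  ultimately show "\<exists>V. openin T V \<and> u \<in> V \<and> V \<subseteq> unit_space G"
    by (intro exI[of _ ?V] conjI subsetI)
qed

lemma openin_unit_top [simp]: "openin (unit_top G) U \<longleftrightarrow> openin T U \<and> U \<subseteq> unit_space G"
  using openin_open_subtopology[OF openin_units] by (simp add: unit_top_def)

lemma compactin_unit_top [simp]: "compactin (unit_top G) U \<longleftrightarrow> compactin T U \<and> U \<subseteq> unit_space G"
  by (simp add: unit_top_def compactin_subtopology)

text \<open>Openness climbs two levels: from the image of B to the unit space by the homeomorphism,
  and from the unit space to the arrows by \<open>openin_units\<close>.\<close>

lemma bisection_image_openin:
  assumes B: "open_bisection G B" and C: "openin T C" "C \<subseteq> B"
  shows "openin T (rng ` C)" "openin T (src ` C)"
proof -
  have *: "openin (subtopology T B) C" using C B by (simp add: openin_open_subtopology bisection_openin)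
  have "openin (subtopology (unit_top G) (rng ` B)) (rng ` C)"
    "openin (subtopology (unit_top G) (src ` B)) (src ` C)"
    using B * unfolding open_bisection_def
    by (meson homeomorphic_imp_open_map open_map_def)+
  moreover have "openin (unit_top G) (rng ` B)" "openin (unit_top G) (src ` B)"
    using B by (auto simp only: open_bisection_def)
  ultimately have "openin (unit_top G) (rng ` C)" "openin (unit_top G) (src ` C)"
    using openin_trans_full by blast+
  then show "openin T (rng ` C)" "openin T (src ` C)" by simp_all
qed

text \<open>The set W confines the cover. It is taken to be all arrows when functions are
  decomposed, and the complement of the units when effectiveness is applied.\<close>

lemma finite_bisection_cover:
  assumes "compactin T K" "openin T W" "K \<subseteq> W"
  obtains \<F> where "finite \<F>" "\<And>B. B \<in> \<F> \<Longrightarrow> compact_open_bisection G B" "\<And>B. B \<in> \<F> \<Longrightarrow> B \<subseteq> W"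
    "K \<subseteq> \<Union>\<F>"
proof -
  let ?\<U> = "{B. compact_open_bisection G B \<and> B \<subseteq> W}"
  have "K \<subseteq> \<Union>?\<U>"
  proof
    fix x assume "x \<in> K"
    then obtain B where "compact_open_bisection G B" "x \<in> B" "B \<subseteq> W"
      using ample[OF assms(2), of x] assms(3) by auto
    then show "x \<in> \<Union>?\<U>" by blast
  qed
  then obtain \<F> where "finite \<F>" "\<F> \<subseteq> ?\<U>" "K \<subseteq> \<Union>\<F>"
    using compactinD[OF assms(1), of ?\<U>] cob_openin by auto
  then show thesis using that[of \<F>] by blast
qed

end

section \<open>The Steinberg algebra\<close>

context ample_Hausdorff_groupoid
begin

abbreviation conv (infixl "\<star>" 70) where "f \<star> g \<equiv> convolution G f g"

abbreviation SA :: "('g \<Rightarrow> 'k::field) set" where "SA \<equiv> carrier (steinberg_algebra G)"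

section \<open>Locally constant functions of compact support\<close>

lemma compactin_closedin: "compactin T K \<Longrightarrow> closedin T K"
  using Hausdorff compactin_imp_closedin by blast

lemma locally_constant_nhd:
  assumes "locally_constant_on T f" "x \<in> arrows G"
  obtains V where "openin T V" "x \<in> V" "\<And>y. y \<in> V \<Longrightarrow> f y = f x"
proof -
  have "\<exists>V. openin T V \<and> x \<in> V \<and> (\<forall>y\<in>V. f y = f x)"
    using assms by (simp add: locally_constant_on_def)
  then show thesis using that by blast
qed

text \<open>The complement is the preimage of the complement of S, hence open. With S the nonzero
  scalars this shows that supports are closed without passing to a closure.\<close>

lemma locally_constant_closedin:
  assumes "locally_constant_on T f"
  shows "closedin T {x \<in> arrows G. f x \<in> S}"
proof -
  have "openin T {x \<in> arrows G. f x \<notin> S}"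
  proof (subst openin_subopen, intro ballI)
    fix x assume x: "x \<in> {x \<in> arrows G. f x \<notin> S}"
    then have "x \<in> arrows G" by simp
    from locally_constant_nhd[OF assms this]
    obtain V where V: "openin T V" "x \<in> V" "\<And>y. y \<in> V \<Longrightarrow> f y = f x" by blast
    have "V \<subseteq> {x \<in> arrows G. f x \<notin> S}"
    proof
      fix y assume "y \<in> V"
      then show "y \<in> {x \<in> arrows G. f x \<notin> S}" using x V(3)[of y] openin_subset[OF V(1)] by auto
    qed
    then show "\<exists>V. openin T V \<and> x \<in> V \<and> V \<subseteq> {x \<in> arrows G. f x \<notin> S}"
      using V(1,2) by blast
  qed
  moreover have "arrows G - {x \<in> arrows G. f x \<in> S} = {x \<in> arrows G. f x \<notin> S}" by auto
  ultimately show ?thesis by (auto simp: closedin_def)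
qed

text \<open>The closure in the definition disappears because the nonvanishing set is closed already,
  and compactness in \<open>T\<close> contains the clause that f vanishes off the arrows.\<close>

lemma SA_iff:
  "f \<in> SA \<longleftrightarrow> locally_constant_on T f \<and> compactin T {x. f x \<noteq> 0}"
proof -
  have "{x. f x \<noteq> 0} \<subseteq> arrows G \<longleftrightarrow> (\<forall>x. x \<notin> arrows G \<longrightarrow> f x = 0)" by auto
  moreover have "T closure_of {x. f x \<noteq> 0} = {x. f x \<noteq> 0}"
    if "locally_constant_on T f" "{x. f x \<noteq> 0} \<subseteq> arrows G"
  proof -
    have "{x \<in> arrows G. f x \<in> - {0}} = {x. f x \<noteq> 0}" using that by auto
    then show ?thesis using locally_constant_closedin[OF that(1), of "- {0}"] closure_of_closedin by metis
  qed
  moreover have "{x \<in> arrows G. f x \<noteq> 0} = {x. f x \<noteq> 0}" if "{x. f x \<noteq> 0} \<subseteq> arrows G" using that by auto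
  ultimately show ?thesis using compactin_subset_topspace[of T "{x. f x \<noteq> 0}"]
    by (auto simp: steinberg_algebra_def compactly_supported_on_def)
qed

lemma SA_locally_constant: "f \<in> SA \<Longrightarrow> locally_constant_on T f"
  and SA_compact: "f \<in> SA \<Longrightarrow> compactin T {x. f x \<noteq> 0}"
  by (simp_all add: SA_iff)

lemma SA_arrow: "f \<in> SA \<Longrightarrow> f x \<noteq> 0 \<Longrightarrow> x \<in> arrows G"
  using compactin_subset_topspace[OF SA_compact] by auto

lemmas SA_nhd = locally_constant_nhd[OF SA_locally_constant]

lemma SA_closedI:
  assumes "locally_constant_on T f" "compactin T K" "{x. f x \<noteq> 0} \<subseteq> K"
  shows "f \<in> SA"
proof -
  have "{x \<in> arrows G. f x \<in> - {0}} = {x. f x \<noteq> 0}"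
    using assms(3) compactin_subset_topspace[OF assms(2)] by auto
  then show ?thesis
    using closed_compactin[OF assms(2,3)] locally_constant_closedin[OF assms(1), of "- {0}"] assms(1)
    by (simp add: SA_iff)
qed

text \<open>One closure argument for sums, pointwise products and restrictions alike; h 0 0 = 0
  keeps the new support inside the union of the old ones.\<close>

lemma SA_combine:
  assumes f: "f \<in> SA" and g: "g \<in> SA" and 0: "h 0 0 = 0"
  shows "(\<lambda>x. h (f x) (g x)) \<in> SA"
proof (rule SA_closedI)
  show "compactin T ({x. f x \<noteq> 0} \<union> {x. g x \<noteq> 0})"
    using f g by (intro compactin_Un SA_compact)
  show "{x. h (f x) (g x) \<noteq> 0} \<subseteq> {x. f x \<noteq> 0} \<union> {x. g x \<noteq> 0}" using 0 by force
  show "locally_constant_on T (\<lambda>x. h (f x) (g x))"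
    unfolding locally_constant_on_def
  proof
    fix x assume "x \<in> topspace T"
    then have x: "x \<in> arrows G" by simp
    from SA_nhd[OF f x] obtain V where V: "openin T V" "x \<in> V" "\<And>y. y \<in> V \<Longrightarrow> f y = f x"
      by blast
    from SA_nhd[OF g x] obtain W where W: "openin T W" "x \<in> W" "\<And>y. y \<in> W \<Longrightarrow> g y = g x"
      by blast
    have "h (f y) (g y) = h (f x) (g x)" if "y \<in> V \<inter> W" for y
      using that V(3)[of y] W(3)[of y] by simp
    moreover have "openin T (V \<inter> W)" "x \<in> V \<inter> W" using V W by blast+
    ultimately show "\<exists>V. openin T V \<and> x \<in> V \<and> (\<forall>y\<in>V. h (f y) (g y) = h (f x) (g x))"
      by blast
  qed
qed

text \<open>Local constancy outside C needs C closed, which compactness gives in a Hausdorff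
  space.\<close>

lemma indicator_SA:
  assumes "openin T C" "compactin T C"
  shows "indicator C \<in> (SA :: ('g \<Rightarrow> 'k::field) set)"
proof (rule SA_closedI)
  show "compactin T C" by fact
  show "{x. (indicator C x :: 'k) \<noteq> 0} \<subseteq> C" by (auto simp: indicator_def)
  show "locally_constant_on T (indicator C :: 'g \<Rightarrow> 'k)"
    unfolding locally_constant_on_def
  proof
    fix x assume x: "x \<in> topspace T"
    have "openin T (arrows G - C)" using compactin_closedin[OF assms(2)] by (auto simp: closedin_def)
    with assms(1) x show "\<exists>V. openin T V \<and> x \<in> V \<and> (\<forall>y\<in>V. (indicator C y :: 'k) = indicator C x)"
      by (cases "x \<in> C") (auto intro: exI[of _ C] exI[of _ "arrows G - C"])
  qed
qed

lemma zero_SA: "(\<lambda>_. 0) \<in> SA"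
  by (rule SA_closedI[of _ "{}"]) (auto simp: locally_constant_on_def intro: exI[of _ "topspace T"])

lemma SA_map: "f \<in> SA \<Longrightarrow> h 0 = 0 \<Longrightarrow> (\<lambda>x. h (f x)) \<in> SA"
  using SA_combine[OF _ zero_SA, of f "\<lambda>a _. h a"] by simp

text \<open>Cover the support by finitely many bisections and split off one at a time: f times the
  indicator of B lives on B, and the rest is covered by the remaining bisections even if these
  overlap B. Statements additive in f thus reduce to functions on one bisection, where range is
  injective and a convolution has at most one term at each point.\<close>

lemma SA_induct [consumes 1, case_names zero bisection add]:
  assumes f: "f \<in> SA"
    and zero: "P (\<lambda>_. 0)"
    and bisection: "\<And>f B. \<lbrakk>f \<in> SA; compact_open_bisection G B; \<And>x. f x \<noteq> 0 \<Longrightarrow> x \<in> B\<rbrakk> \<Longrightarrow> P f"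
    and add: "\<And>f g. \<lbrakk>f \<in> SA; g \<in> SA; P f; P g\<rbrakk> \<Longrightarrow> P (\<lambda>x. f x + g x)"
  shows "P f"
proof -
  have "P f" if "finite \<F>" "\<And>B. B \<in> \<F> \<Longrightarrow> compact_open_bisection G B" "{x. f x \<noteq> 0} \<subseteq> \<Union>\<F>" "f \<in> SA"
    for \<F> f using that
  proof (induction \<F> arbitrary: f)
    case empty
    then have "f = (\<lambda>_. 0)" by auto
    then show ?case using zero by simp
  next
    case (insert B \<F>)
    have B: "compact_open_bisection G B" using insert.prems by simp
    let ?f = "\<lambda>x. f x * indicator B x" and ?g = "\<lambda>x. f x * (1 - indicator B x)"
    have ind: "indicator B \<in> SA" using indicator_SA cob_openin[OF B] cob_compact[OF B] by blast
    have SA: "?f \<in> SA" "?g \<in> SA"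
      using SA_combine[OF insert.prems(3) ind, of "(*)"]
        SA_combine[OF insert.prems(3) ind, of "\<lambda>a b. a * (1 - b)"] by simp_all
    have "P ?f" by (rule bisection[OF SA(1) B]) (auto simp: indicator_def split: if_splits)
    moreover have "P ?g"
      using insert.prems SA by (intro insert.IH) (auto simp: indicator_def split: if_splits)
    moreover have "(\<lambda>x. ?f x + ?g x) = f" by (auto simp: algebra_simps)
    ultimately show ?case using add[OF SA] by simp
  qed
  moreover obtain \<F> where "finite \<F>" "\<And>B. B \<in> \<F> \<Longrightarrow> compact_open_bisection G B" "{x. f x \<noteq> 0} \<subseteq> \<Union>\<F>"
    using finite_bisection_cover[OF SA_compact[OF f] openin_arrows] SA_arrow[OF f]
    by (metis (mono_tags, lifting) mem_Collect_eq subsetI)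
  ultimately show ?thesis using f by blast
qed


section \<open>Convolution as a finite sum over a range fibre\<close>

lemma finite_fibre:
  assumes f: "f \<in> SA"
  shows "finite {\<alpha>. f \<alpha> \<noteq> 0 \<and> rng \<alpha> = u}"
  using f
proof (induction rule: SA_induct)
  case (bisection f B)
  show ?case
  proof (cases "\<exists>\<alpha>\<in>B. rng \<alpha> = u")
    case True
    then obtain \<alpha> where \<alpha>: "\<alpha> \<in> B" "rng \<alpha> = u" by blast
    have "{\<alpha>. f \<alpha> \<noteq> 0 \<and> rng \<alpha> = u} \<subseteq> {\<alpha>}"
    proof
      fix \<beta> assume "\<beta> \<in> {\<alpha>. f \<alpha> \<noteq> 0 \<and> rng \<alpha> = u}"
      then have "\<beta> \<in> B" "rng \<beta> = rng \<alpha>" using bisection(3) \<alpha> by auto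
      then show "\<beta> \<in> {\<alpha>}" using inj_onD[OF cob_inj_range[OF bisection(2)]] \<alpha>(1) by blast
    qed
    then show ?thesis using finite_subset by blast
  next
    case False
    then have "{\<alpha>. f \<alpha> \<noteq> 0 \<and> rng \<alpha> = u} = {}" using bisection(3) by blast
    then show ?thesis by (metis finite.emptyI)
  qed
next
  case (add f g)
  have "{\<alpha>. f \<alpha> + g \<alpha> \<noteq> 0 \<and> rng \<alpha> = u}
      \<subseteq> {\<alpha>. f \<alpha> \<noteq> 0 \<and> rng \<alpha> = u} \<union> {\<alpha>. g \<alpha> \<noteq> 0 \<and> rng \<alpha> = u}" by auto
  then show ?case using add finite_subset by blast
qed simp

lemma conv_nonzeroE:
  assumes "(f \<star> g) \<gamma> \<noteq> 0"
  obtains \<alpha> \<beta> where "\<alpha> \<in> arrows G" "\<beta> \<in> arrows G" "src \<alpha> = rng \<beta>" "\<alpha> \<cdot> \<beta> = \<gamma>" "f \<alpha> \<noteq> 0" "g \<beta> \<noteq> 0"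
proof -
  from assms have "{(\<alpha>, \<beta>). (\<alpha>, \<beta>) \<in> composable G \<and> \<alpha> \<cdot> \<beta> = \<gamma> \<and> f \<alpha> \<noteq> 0 \<and> g \<beta> \<noteq> 0} \<noteq> {}"
    unfolding convolution_def by (metis (no_types, lifting) sum.empty)
  then show thesis using that by auto
qed

text \<open>A factorization of \<gamma> is determined by its left factor \<alpha>, the right one
  being \<open>iv \<alpha> \<cdot> \<gamma>\<close>. The index set S may exceed the support, so
  several convolutions can be expanded over a common set.\<close>

lemma conv_sum:
  assumes \<gamma>: "\<gamma> \<in> arrows G" and S: "finite S" "S \<subseteq> {\<alpha> \<in> arrows G. rng \<alpha> = rng \<gamma>}"
    and f: "\<And>\<alpha>. \<lbrakk>\<alpha> \<in> arrows G; f \<alpha> \<noteq> 0; rng \<alpha> = rng \<gamma>\<rbrakk> \<Longrightarrow> \<alpha> \<in> S"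
  shows "(f \<star> g) \<gamma> = (\<Sum>\<alpha>\<in>S. f \<alpha> * g (iv \<alpha> \<cdot> \<gamma>))"
proof -
  have "(f \<star> g) \<gamma> = (\<Sum>\<alpha> \<in> {\<alpha> \<in> S. f \<alpha> \<noteq> 0 \<and> g (iv \<alpha> \<cdot> \<gamma>) \<noteq> 0}. f \<alpha> * g (iv \<alpha> \<cdot> \<gamma>))"
    unfolding convolution_def
    by (rule sum.reindex_bij_witness[of _ "\<lambda>\<alpha>. (\<alpha>, iv \<alpha> \<cdot> \<gamma>)" fst]) (use S f \<gamma> in auto)
  also have "\<dots> = (\<Sum>\<alpha>\<in>S. f \<alpha> * g (iv \<alpha> \<cdot> \<gamma>))"
    by (rule sum.mono_neutral_left) (use S in auto)
  finally show ?thesis .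
qed

lemma conv_sum_fibre:
  assumes "f \<in> SA" "\<gamma> \<in> arrows G"
  shows "(f \<star> g) \<gamma> = (\<Sum>\<alpha> | f \<alpha> \<noteq> 0 \<and> rng \<alpha> = rng \<gamma>. f \<alpha> * g (iv \<alpha> \<cdot> \<gamma>))"
  by (rule conv_sum) (use assms finite_fibre SA_arrow in auto)

lemma conv_outside: "\<gamma> \<notin> arrows G \<Longrightarrow> (f \<star> g) \<gamma> = 0"
  by (metis comp_simps(1) conv_nonzeroE)

lemma conv_eq_left:
  assumes "\<gamma> \<in> arrows G" "\<alpha> \<in> arrows G" "rng \<alpha> = rng \<gamma>"
    and "\<And>\<beta>. \<lbrakk>\<beta> \<in> arrows G; f \<beta> \<noteq> 0; rng \<beta> = rng \<alpha>\<rbrakk> \<Longrightarrow> \<beta> = \<alpha>"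
  shows "(f \<star> g) \<gamma> = f \<alpha> * g (iv \<alpha> \<cdot> \<gamma>)"
proof -
  have "(f \<star> g) \<gamma> = (\<Sum>\<alpha>\<in>{\<alpha>}. f \<alpha> * g (iv \<alpha> \<cdot> \<gamma>))"
  proof (rule conv_sum)
    fix \<beta> assume "\<beta> \<in> arrows G" "f \<beta> \<noteq> 0" "rng \<beta> = rng \<gamma>"
    then show "\<beta> \<in> {\<alpha>}" using assms(3,4) by (metis singletonI)
  qed (use assms(1-3) in auto)
  then show ?thesis by simp
qed

text \<open>The mirror image of \<open>conv_eq_left\<close>: here the right factor is the one that
  is unique in its source fibre, and it determines the left factor.\<close>

lemma conv_eq_right:
  assumes "\<gamma> \<in> arrows G" "\<beta> \<in> arrows G" "src \<beta> = src \<gamma>"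
    and "\<And>\<beta>'. \<lbrakk>\<beta>' \<in> arrows G; g \<beta>' \<noteq> 0; src \<beta>' = src \<beta>\<rbrakk> \<Longrightarrow> \<beta>' = \<beta>"
  shows "(f \<star> g) \<gamma> = f (\<gamma> \<cdot> iv \<beta>) * g \<beta>"
proof -
  have "(f \<star> g) \<gamma> = (\<Sum>(\<alpha>, \<beta>) \<in> {(\<gamma> \<cdot> iv \<beta>, \<beta>)}. f \<alpha> * g \<beta>)"
    unfolding convolution_def
  proof (rule sum.mono_neutral_left)
    show "{(\<alpha>, \<beta>). (\<alpha>, \<beta>) \<in> composable G \<and> \<alpha> \<cdot> \<beta> = \<gamma> \<and> f \<alpha> \<noteq> 0 \<and> g \<beta> \<noteq> 0} \<subseteq> {(\<gamma> \<cdot> iv \<beta>, \<beta>)}"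
    proof safe
      fix \<alpha> \<delta> assume *: "(\<alpha>, \<delta>) \<in> composable G" "\<gamma> = \<alpha> \<cdot> \<delta>" "f \<alpha> \<noteq> 0" "g \<delta> \<noteq> 0"
      then have "\<delta> = \<beta>" using assms(3) by (intro assms(4)) auto
      with * show "\<alpha> = \<alpha> \<cdot> \<delta> \<cdot> iv \<beta>" "\<delta> = \<beta>" by auto
    qed
  qed (use assms(1-3) in auto)
  then show ?thesis by simp
qed

lemma conv_add_right:
  assumes "f \<in> SA"
  shows "f \<star> (\<lambda>x. g x + h x) = (\<lambda>x. (f \<star> g) x + (f \<star> h) x)"
proof
  fix \<gamma> show "(f \<star> (\<lambda>x. g x + h x)) \<gamma> = (f \<star> g) \<gamma> + (f \<star> h) \<gamma>"
    by (cases "\<gamma> \<in> arrows G")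
      (simp_all add: conv_outside conv_sum_fibre[OF assms] distrib_left sum.distrib)
qed

lemma conv_add_left:
  assumes "f \<in> SA" "g \<in> SA"
  shows "(\<lambda>x. f x + g x) \<star> h = (\<lambda>x. (f \<star> h) x + (g \<star> h) x)"
proof
  fix \<gamma>
  \<comment> \<open>Cancellation can make the support of f + g smaller than the union of the two
    supports, so all three convolutions are expanded over the union of the fibres.\<close>
  let ?S = "{\<alpha>. f \<alpha> \<noteq> 0 \<and> rng \<alpha> = rng \<gamma>} \<union> {\<alpha>. g \<alpha> \<noteq> 0 \<and> rng \<alpha> = rng \<gamma>}"
  show "((\<lambda>x. f x + g x) \<star> h) \<gamma> = (f \<star> h) \<gamma> + (g \<star> h) \<gamma>"
  proof (cases "\<gamma> \<in> arrows G")
    case True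
    have S: "finite ?S" "?S \<subseteq> {\<alpha> \<in> arrows G. rng \<alpha> = rng \<gamma>}"
      using finite_fibre assms SA_arrow by auto
    show ?thesis
    proof -
      have "(k \<star> h) \<gamma> = (\<Sum>\<alpha>\<in>?S. k \<alpha> * h (iv \<alpha> \<cdot> \<gamma>))" if "\<And>\<alpha>. k \<alpha> \<noteq> 0 \<Longrightarrow> f \<alpha> \<noteq> 0 \<or> g \<alpha> \<noteq> 0" for k
        using that by (intro conv_sum[OF True S]) auto
      from this[of f] this[of g] this[of "\<lambda>x. f x + g x"] show ?thesis
        by (simp only: distrib_right sum.distrib) fastforce
    qed
  qed (simp add: conv_outside)
qed

lemma conv_zero_left [simp]: "(\<lambda>_. 0) \<star> f = (\<lambda>_. 0)"
  using conv_nonzeroE[of "\<lambda>_. 0" f] by blast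

section \<open>Closure under convolution and associativity, one bisection at a time\<close>

lemma conv_on_bisection:
  assumes B: "compact_open_bisection G B" and f: "\<And>x. f x \<noteq> 0 \<Longrightarrow> x \<in> B"
    and "\<delta> \<in> arrows G" "\<alpha> \<in> B" "rng \<alpha> = rng \<delta>"
  shows "(f \<star> g) \<delta> = f \<alpha> * g (iv \<alpha> \<cdot> \<delta>)"
proof (rule conv_eq_left)
  show "\<alpha> \<in> arrows G" using cob_subset[OF B] assms(4) by blast
  show "\<beta> = \<alpha>" if "f \<beta> \<noteq> 0" "rng \<beta> = rng \<alpha>" for \<beta>
    using inj_onD[OF cob_inj_range[OF B] that(2) f[OF that(1)] assms(4)] .
qed fact+

lemma conv_off_bisection:
  assumes "\<And>x. f x \<noteq> 0 \<Longrightarrow> x \<in> B" "rng \<delta> \<notin> rng ` B"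
  shows "(f \<star> g) \<delta> = 0"
  using assms by (metis conv_nonzeroE comp_simps(2) imageI)

lemma conv_bisection_locally_constant:
  assumes f: "f \<in> SA" and B: "compact_open_bisection G B" "\<And>x. f x \<noteq> 0 \<Longrightarrow> x \<in> B" and g: "g \<in> SA"
  shows "locally_constant_on T (f \<star> g)"
  unfolding locally_constant_on_def
proof
  fix \<gamma> assume "\<gamma> \<in> topspace T"
  then have \<gamma>: "\<gamma> \<in> arrows G" by simp
  note eval = conv_on_bisection[where f = f and B = B, OF B]
  show "\<exists>V. openin T V \<and> \<gamma> \<in> V \<and> (\<forall>\<delta>\<in>V. (f \<star> g) \<delta> = (f \<star> g) \<gamma>)"
  proof (cases "rng \<gamma> \<in> rng ` B")
    case False
    note * = conv_off_bisection[where f = f and B = B, OF B(2)]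
    let ?V = "{\<delta> \<in> arrows G. rng \<delta> \<in> arrows G - rng ` B}"
    have "closedin T (rng ` B)"
      using image_compactin[OF cob_compact[OF B(1)] continuous_range] compactin_closedin by blast
    then have "openin T ?V" by (intro openin_range_vimage) (simp add: openin_diff)
    moreover have "\<gamma> \<in> ?V" using \<gamma> False by simp
    ultimately show ?thesis using * False by (intro exI[of _ ?V]) auto
  next
    case True
    then obtain \<alpha> where \<alpha>: "\<alpha> \<in> B" "rng \<alpha> = rng \<gamma>" by auto
    have \<alpha>': "\<alpha> \<in> arrows G" using \<alpha> cob_subset[OF B(1)] by blast
    obtain N where N: "openin T N" "\<alpha> \<in> N" "\<And>x. x \<in> N \<Longrightarrow> f x = f \<alpha>" using SA_nhd[OF f \<alpha>'] by blast
    have iv: "iv \<alpha> \<cdot> \<gamma> \<in> arrows G" using \<alpha> \<alpha>' \<gamma> by simp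
    obtain M where M: "openin T M" "iv \<alpha> \<cdot> \<gamma> \<in> M" "\<And>x. x \<in> M \<Longrightarrow> g x = g (iv \<alpha> \<cdot> \<gamma>)"
      using SA_nhd[OF g, of "iv \<alpha> \<cdot> \<gamma>"] iv by blast
    \<comment> \<open>The map sending \<alpha>, \<delta> to
      \<open>iv \<alpha> \<cdot> \<delta>\<close> is composable only for equal ranges. The preimage
      of M is therefore open relative to \<open>?D\<close>, and a box P, Q is chosen inside an open
      set of the full product that restricts to it.\<close>
    let ?D = "{p. rng (fst p) = rng (snd p)}"
    let ?X = "subtopology (prod_topology T T) ?D"
    have "continuous_map ?X T (\<lambda>p. iv (fst p) \<cdot> snd p)"
      by (intro continuous_comp_maps continuous_map_from_subtopology continuous_map_snd
          continuous_map_compose[OF continuous_map_fst continuous_inverse, unfolded o_def]) auto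
    from openin_continuous_map_preimage[OF this M(1)]
    obtain O' where O': "openin (prod_topology T T) O'"
      "{p \<in> topspace ?X. iv (fst p) \<cdot> snd p \<in> M} = O' \<inter> ?D"
      by (auto simp: openin_subtopology)
    moreover have "(\<alpha>, \<gamma>) \<in> {p \<in> topspace ?X. iv (fst p) \<cdot> snd p \<in> M}"
      using \<alpha> \<alpha>' \<gamma> M(2) by simp
    ultimately have "(\<alpha>, \<gamma>) \<in> O'" by blast
    then obtain P Q where PQ: "openin T P" "openin T Q" "\<alpha> \<in> P" "\<gamma> \<in> Q" "P \<times> Q \<subseteq> O'"
      using O'(1) openin_prod_topology_alt by metis
    \<comment> \<open>N fixes the value of f, P keeps the argument of g in M, and B gives
      uniqueness. Requiring the range of \<delta> to lie in the open image of \<open>?W\<close>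
      forces the one relevant arrow of B into \<open>?W\<close>.\<close>
    let ?W = "B \<inter> N \<inter> P"
    let ?V = "Q \<inter> {\<delta> \<in> arrows G. rng \<delta> \<in> rng ` ?W}"
    have "openin T ?W" using N(1) PQ(1) cob_openin[OF B(1)] by blast
    then have "openin T (rng ` ?W)" using bisection_image_openin[OF cob_bisection[OF B(1)]] by blast
    then have "openin T ?V" using PQ openin_range_vimage by blast
    moreover have "\<gamma> \<in> ?V" using \<gamma> \<alpha> N(2) PQ(3,4) by (auto intro!: image_eqI[of _ _ \<alpha>])
    moreover have "(f \<star> g) \<delta> = (f \<star> g) \<gamma>" if \<delta>: "\<delta> \<in> ?V" for \<delta>
    proof -
      obtain \<alpha>1 where \<alpha>1: "\<alpha>1 \<in> ?W" "rng \<alpha>1 = rng \<delta>" "\<delta> \<in> arrows G" using \<delta> by auto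
      then have "(\<alpha>1, \<delta>) \<in> O' \<inter> ?D" using PQ \<delta> by auto
      then have "(\<alpha>1, \<delta>) \<in> {p \<in> topspace ?X. iv (fst p) \<cdot> snd p \<in> M}" using O'(2) by simp
      then have "iv \<alpha>1 \<cdot> \<delta> \<in> M" by simp
      then show ?thesis
        using \<alpha>1 N(3)[of \<alpha>1] M(3)[of "iv \<alpha>1 \<cdot> \<delta>"] \<alpha> \<gamma> eval[where \<delta> = \<delta> and \<alpha> = \<alpha>1]
          eval[where \<delta> = \<gamma> and \<alpha> = \<alpha>]
        by auto
    qed
    ultimately show ?thesis by blast
  qed
qed

text \<open>An equalizer of continuous maps into a Hausdorff space. It makes the composable pairs in
  a product of two compact supports compact, and their image under multiplication contains the
  support of the convolution.\<close>

lemma closedin_composable: "closedin (prod_topology T T) (composable G)"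
proof -
  have "closedin (prod_topology T T)
      {p \<in> topspace (prod_topology T T). (src \<circ> fst) p = (rng \<circ> snd) p}"
    by (rule closedin_continuous_maps_eq[OF Hausdorff
          continuous_map_compose[OF continuous_map_fst continuous_source]
          continuous_map_compose[OF continuous_map_snd continuous_range]])
  moreover have "{p \<in> topspace (prod_topology T T). (src \<circ> fst) p = (rng \<circ> snd) p} = composable G"
    by (auto simp: composable_def)
  ultimately show ?thesis by simp
qed

lemma conv_SA:
  assumes f: "f \<in> SA" and g: "g \<in> SA"
  shows "f \<star> g \<in> SA"
  using f
proof (induction rule: SA_induct)
  case zero
  then show ?case by (simp add: zero_SA)
next
  case (add f h)
  then show ?case using SA_combine[of "f \<star> g" "h \<star> g" "(+)"] by (simp add: conv_add_left)
next
  case (bisection f B)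
  let ?K = "composable G \<inter> {x. f x \<noteq> 0} \<times> {x. g x \<noteq> 0}"
  have "compactin (prod_topology T T) ({x. f x \<noteq> 0} \<times> {x. g x \<noteq> 0})"
    using SA_compact[OF bisection(1)] SA_compact[OF g] by (simp add: compactin_Times)
  then have "compactin (subtopology (prod_topology T T) (composable G)) ?K"
    using closed_Int_compactin[OF closedin_composable] by (simp add: compactin_subtopology)
  from image_compactin[OF this continuous_comp]
  have "compactin T ((\<lambda>(\<alpha>, \<beta>). \<alpha> \<cdot> \<beta>) ` ?K)" .
  moreover have "{\<gamma>. (f \<star> g) \<gamma> \<noteq> 0} \<subseteq> (\<lambda>(\<alpha>, \<beta>). \<alpha> \<cdot> \<beta>) ` ?K"
  proof
    fix \<gamma> assume "\<gamma> \<in> {\<gamma>. (f \<star> g) \<gamma> \<noteq> 0}"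
    then obtain \<alpha> \<beta> where "(\<alpha>, \<beta>) \<in> ?K" "\<gamma> = \<alpha> \<cdot> \<beta>" by (auto elim!: conv_nonzeroE)
    then show "\<gamma> \<in> (\<lambda>(\<alpha>, \<beta>). \<alpha> \<cdot> \<beta>) ` ?K" by (metis (mono_tags, lifting) case_prod_conv image_eqI)
  qed
  ultimately show ?case using SA_closedI conv_bisection_locally_constant[OF bisection g] by blast
qed

text \<open>By additivity f may be supported in one bisection. At \<gamma> a single arrow \<alpha>
  of it matters: the value of f there factors out, and translation by \<alpha> identifies what is
  left on both sides with the convolution of g and h at
  \<open>iv \<alpha> \<cdot> \<gamma>\<close>.\<close>

lemma conv_assoc:
  assumes f: "f \<in> SA" and g: "g \<in> SA" and h: "h \<in> SA"
  shows "(f \<star> g) \<star> h = f \<star> (g \<star> h)"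
  using f
proof (induction rule: SA_induct)
  case zero
  then show ?case by simp
next
  case (add f1 f2)
  then show ?case by (simp add: conv_add_left conv_SA g)
next
  case (bisection f B)
  note B = bisection(2)
  note eval = conv_on_bisection[where f = f and B = B, OF bisection(2,3)]
  note eval0 = conv_off_bisection[where f = f and B = B, OF bisection(3)]
  show ?case
  proof
    fix \<gamma>
    consider "\<gamma> \<notin> arrows G" | "\<gamma> \<in> arrows G" "rng \<gamma> \<notin> rng ` B"
      | \<alpha> where "\<gamma> \<in> arrows G" "\<alpha> \<in> B" "rng \<alpha> = rng \<gamma>" by (metis imageE)
    then show "((f \<star> g) \<star> h) \<gamma> = (f \<star> (g \<star> h)) \<gamma>"
    proof cases
      case 1
      then show ?thesis by (simp add: conv_outside)
    next
      case 2
      have "((f \<star> g) \<star> h) \<gamma> = 0"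
        using 2 eval0 by (metis conv_nonzeroE comp_simps(2))
      then show ?thesis using 2 by (simp add: eval0)
    next
      case 3
      have \<alpha>: "\<alpha> \<in> arrows G" using 3 cob_subset[OF B] by blast
      let ?D = "{\<delta>. g \<delta> \<noteq> 0 \<and> rng \<delta> = src \<alpha>}"
      have D: "finite ?D" "?D \<subseteq> arrows G" using finite_fibre[OF g] SA_arrow[OF g] by auto
      have inj: "inj_on ((\<cdot>) \<alpha>) ?D"
        by (rule inj_on_inverseI[of _ "(\<cdot>) (iv \<alpha>)"]) (use D \<alpha> in auto)
      \<comment> \<open>If \<open>f \<star> g\<close> is nonzero at \<beta> in this range fibre,
        then \<beta> is \<alpha> times an arrow of \<open>?D\<close>, so the index set may be taken
        to be the translate of \<open>?D\<close>.\<close>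
      have "((f \<star> g) \<star> h) \<gamma> = (\<Sum>\<beta> \<in> (\<cdot>) \<alpha> ` ?D. (f \<star> g) \<beta> * h (iv \<beta> \<cdot> \<gamma>))"
      proof (rule conv_sum)
        show "(\<cdot>) \<alpha> ` ?D \<subseteq> {\<beta> \<in> arrows G. rng \<beta> = rng \<gamma>}" using D \<alpha> 3 by auto
        fix \<beta> assume \<beta>: "\<beta> \<in> arrows G" "(f \<star> g) \<beta> \<noteq> 0" "rng \<beta> = rng \<gamma>"
        then have "iv \<alpha> \<cdot> \<beta> \<in> ?D" using eval[where \<delta> = \<beta> and \<alpha> = \<alpha> and g = g] 3 \<alpha> by auto
        moreover have "\<beta> = \<alpha> \<cdot> (iv \<alpha> \<cdot> \<beta>)" using \<beta> 3 \<alpha> by simp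
        ultimately show "\<beta> \<in> (\<cdot>) \<alpha> ` ?D" by blast
      qed (use D 3 in auto)
      also have "\<dots> = (\<Sum>\<delta>\<in>?D. (f \<star> g) (\<alpha> \<cdot> \<delta>) * h (iv (\<alpha> \<cdot> \<delta>) \<cdot> \<gamma>))"
        using inj by (simp add: sum.reindex)
      also have "\<dots> = (\<Sum>\<delta>\<in>?D. f \<alpha> * (g \<delta> * h (iv \<delta> \<cdot> (iv \<alpha> \<cdot> \<gamma>))))"
      proof (rule sum.cong)
        fix \<delta> assume "\<delta> \<in> ?D"
        then have \<delta>: "\<delta> \<in> arrows G" "rng \<delta> = src \<alpha>" using D by auto
        \<comment> \<open>Writing \<gamma> with the factor \<open>\<alpha> \<cdot> \<delta>\<close>
          on its left lets cancellation replace the rule for the inverse of a product.\<close>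
        have "iv (\<alpha> \<cdot> \<delta>) \<cdot> \<gamma> = iv (\<alpha> \<cdot> \<delta>) \<cdot> ((\<alpha> \<cdot> \<delta>) \<cdot> (iv \<delta> \<cdot> (iv \<alpha> \<cdot> \<gamma>)))"
          using \<delta> \<alpha> 3 by (simp add: assoc)
        also have "\<dots> = iv \<delta> \<cdot> (iv \<alpha> \<cdot> \<gamma>)" using \<delta> \<alpha> 3 by (intro cancel(1)) auto
        finally show "(f \<star> g) (\<alpha> \<cdot> \<delta>) * h (iv (\<alpha> \<cdot> \<delta>) \<cdot> \<gamma>) = f \<alpha> * (g \<delta> * h (iv \<delta> \<cdot> (iv \<alpha> \<cdot> \<gamma>)))"
          using \<delta> \<alpha> 3 eval[where \<delta> = "\<alpha> \<cdot> \<delta>" and \<alpha> = \<alpha> and g = g] by (simp add: mult.assoc)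
      qed simp
      also have "\<dots> = f \<alpha> * (g \<star> h) (iv \<alpha> \<cdot> \<gamma>)"
        using 3 \<alpha> by (simp add: conv_sum_fibre[OF g] sum_distrib_left)
      also have "\<dots> = (f \<star> (g \<star> h)) \<gamma>" using 3 by (simp add: eval)
      finally show ?thesis .
    qed
  qed
qed

lemma steinberg_simps [simp]:
  "f \<otimes>\<^bsub>steinberg_algebra G\<^esub> g = f \<star> g"
  "f \<oplus>\<^bsub>steinberg_algebra G\<^esub> g = (\<lambda>x. f x + g x)"
  "\<zero>\<^bsub>steinberg_algebra G\<^esub> = (\<lambda>_. 0)"
  by (simp_all add: steinberg_algebra_def)

lemma nonunital_ring_steinberg: "nonunital_ring (steinberg_algebra G :: ('g \<Rightarrow> 'k::field) ring)"
proof (intro nonunital_ring.intro nonunital_ring_axioms.intro abelian_groupI)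
  fix f :: "'g \<Rightarrow> 'k" assume "f \<in> SA"
  then show "\<exists>g\<in>SA. g \<oplus>\<^bsub>steinberg_algebra G\<^esub> f = \<zero>\<^bsub>steinberg_algebra G\<^esub>"
    using SA_map[of f uminus] by (intro bexI[of _ "\<lambda>x. - f x"]) auto
qed (use SA_combine[of _ _ "(+)"] in
    \<open>simp_all add: zero_SA conv_SA conv_assoc conv_add_left conv_add_right add_ac\<close>)


section \<open>Products with indicators of sets of units\<close>

lemma conv_indicator_left:
  fixes f :: "'g \<Rightarrow> 'k::field"
  assumes "V \<subseteq> unit_space G" "\<gamma> \<in> arrows G"
  shows "(indicator V \<star> f) \<gamma> = indicator V (rng \<gamma>) * f \<gamma>"
proof -
  have "(indicator V \<star> f) \<gamma> = indicator V (rng \<gamma>) * f (iv (rng \<gamma>) \<cdot> \<gamma>)"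
  proof (rule conv_eq_left)
    fix \<beta> assume "(indicator V \<beta> :: 'k) \<noteq> 0" "rng \<beta> = rng (rng \<gamma>)"
    then have "\<beta> \<in> unit_space G" using assms(1) by (auto simp: indicator_def split: if_splits)
    then show "\<beta> = rng \<gamma>" using \<open>rng \<beta> = rng (rng \<gamma>)\<close> assms(2) by simp
  qed (use assms in auto)
  then show ?thesis using assms(2) by simp
qed

lemma conv_indicator_right:
  fixes f :: "'g \<Rightarrow> 'k::field"
  assumes "V \<subseteq> unit_space G" "\<gamma> \<in> arrows G"
  shows "(f \<star> indicator V) \<gamma> = f \<gamma> * indicator V (src \<gamma>)"
proof -
  have "(f \<star> indicator V) \<gamma> = f (\<gamma> \<cdot> iv (src \<gamma>)) * indicator V (src \<gamma>)"
  proof (rule conv_eq_right)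
    fix \<beta> assume "(indicator V \<beta> :: 'k) \<noteq> 0" "src \<beta> = src (src \<gamma>)"
    then have "\<beta> \<in> unit_space G" using assms(1) by (auto simp: indicator_def split: if_splits)
    then show "\<beta> = src \<gamma>" using \<open>src \<beta> = src (src \<gamma>)\<close> assms(2) by simp
  qed (use assms in auto)
  then show ?thesis using assms(2) by simp
qed

lemma conv_indicators:
  assumes "V \<subseteq> unit_space G" "W \<subseteq> unit_space G"
  shows "(indicator V \<star> indicator W :: 'g \<Rightarrow> 'k::field) = indicator (V \<inter> W)"
proof
  fix \<gamma>
  show "(indicator V \<star> indicator W) \<gamma> = (indicator (V \<inter> W) \<gamma> :: 'k)"
  proof (cases "\<gamma> \<in> arrows G")
    case True
    have "(indicator V (rng \<gamma>) * indicator W \<gamma> :: 'k) = indicator (V \<inter> W) \<gamma>"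
      using assms by (cases "\<gamma> \<in> W") (auto simp: indicator_def)
    then show ?thesis using True assms by (simp add: conv_indicator_left)
  next
    case False
    then have "\<gamma> \<notin> V \<inter> W" using assms unit_in_arrows by blast
    then show ?thesis using False by (simp add: conv_outside)
  qed
qed

section \<open>Effectiveness and the shrinking of sets of units\<close>

lemma unit_compact_open_subset:
  assumes "openin T W" "W \<subseteq> unit_space G" "W \<noteq> {}"
  obtains V where "openin T V" "compactin T V" "V \<noteq> {}" "V \<subseteq> W"
proof -
  from assms(3) obtain u where "u \<in> W" by blast
  then obtain B where "compact_open_bisection G B" "u \<in> B" "B \<subseteq> W"
    using ample[OF assms(1)] by blast
  then show thesis using that[of B] cob_openin cob_compact by blast
qed

text \<open>
  An arrow of \<open>B\<close> with distinct source and range has a neighbourhood in \<open>B\<close> on which the source and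
  the range stay in disjoint sets.
\<close>

lemma effective_shrink_bisection:
  assumes eff: "effective_groupoid G"
    and B: "compact_open_bisection G B" "B \<subseteq> arrows G - unit_space G"
    and W: "openin T W" "W \<subseteq> unit_space G" "W \<noteq> {}"
  obtains V where "openin T V" "V \<noteq> {}" "V \<subseteq> W" "\<And>\<gamma>. \<gamma> \<in> B \<Longrightarrow> \<not> (rng \<gamma> \<in> V \<and> src \<gamma> \<in> V)"
proof (cases "\<exists>\<gamma>\<in>B. rng \<gamma> \<in> W \<and> src \<gamma> \<in> W")
  case False
  then show thesis using that[of W] W by blast
next
  case True
  then obtain \<gamma>0 where \<gamma>0: "\<gamma>0 \<in> B" "rng \<gamma>0 \<in> W" "src \<gamma>0 \<in> W" by blast
  \<comment> \<open>Effectiveness supplies some arrow with distinct ends, possibly not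
    \<open>\<gamma>0\<close>. Restricting beforehand to arrows with both ends in W ensures that its
    ends lie there too.\<close>
  let ?B' = "B \<inter> {\<gamma> \<in> arrows G. rng \<gamma> \<in> W} \<inter> {\<gamma> \<in> arrows G. src \<gamma> \<in> W}"
  have "openin T ?B'"
    using cob_openin[OF B(1)] openin_range_vimage[OF W(1)] openin_source_vimage[OF W(1)] by blast
  moreover have "\<gamma>0 \<in> ?B'" using \<gamma>0 cob_subset[OF B(1)] by auto
  ultimately obtain C where C: "compact_open_bisection G C" "\<gamma>0 \<in> C" "C \<subseteq> ?B'"
    using ample[of ?B' \<gamma>0] by blast
  then have "C \<noteq> {}" "C \<subseteq> arrows G - unit_space G" using B(2) by blast+
  then obtain \<gamma> where \<gamma>: "\<gamma> \<in> C" "src \<gamma> \<noteq> rng \<gamma>"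
    using eff C(1) unfolding effective_groupoid_def by blast
  then have \<gamma>a: "\<gamma> \<in> arrows G" using cob_subset[OF C(1)] by blast
  obtain V1 V2 where V12: "openin T V1" "openin T V2" "rng \<gamma> \<in> V1" "src \<gamma> \<in> V2" "disjnt V1 V2"
    using Hausdorff \<gamma>a \<gamma>(2) unfolding Hausdorff_space_def topspace_arrows
    by (metis range_source_arrows)
  let ?D = "C \<inter> {\<gamma> \<in> arrows G. rng \<gamma> \<in> V1} \<inter> {\<gamma> \<in> arrows G. src \<gamma> \<in> V2}"
  have "openin T ?D"
    using cob_openin[OF C(1)] openin_range_vimage[OF V12(1)] openin_source_vimage[OF V12(2)] by blast
  moreover have "?D \<subseteq> C" by blast
  ultimately have "openin T (src ` ?D)"
    using bisection_image_openin(2)[OF cob_bisection[OF C(1)]] by blast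
  moreover have "src ` ?D \<noteq> {}" using \<gamma>(1) \<gamma>a V12(3,4) by blast
  moreover have "src ` ?D \<subseteq> W" using C(3) by blast
  \<comment> \<open>Source is injective on all of B, so an arrow of B whose source comes from
    \<open>?D\<close> belongs to \<open>?D\<close>. Its range is then in V1, while the sources of
    \<open>?D\<close> are in V2.\<close>
  moreover have "\<not> (rng \<delta> \<in> src ` ?D \<and> src \<delta> \<in> src ` ?D)" if "\<delta> \<in> B" for \<delta>
  proof
    assume *: "rng \<delta> \<in> src ` ?D \<and> src \<delta> \<in> src ` ?D"
    then obtain \<epsilon> where \<epsilon>: "\<epsilon> \<in> ?D" "src \<delta> = src \<epsilon>" by blast
    moreover have "\<epsilon> \<in> B" using \<epsilon>(1) C(3) by blast
    ultimately have "\<delta> = \<epsilon>" using inj_onD[OF cob_inj_source[OF B(1)] \<epsilon>(2) that] by blast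
    then have "rng \<delta> \<in> V1" using \<epsilon>(1) by blast
    moreover have "rng \<delta> \<in> V2" using * by force
    ultimately show False using V12(5) by (auto simp: disjnt_def)
  qed
  ultimately show thesis using that by blast
qed

text \<open>Units are the equalizer of \<open>rng\<close> and the identity.\<close>

lemma closedin_units: "closedin T (unit_space G)"
proof -
  have "closedin T {\<gamma> \<in> topspace T. rng \<gamma> = id \<gamma>}"
    by (rule closedin_continuous_maps_eq[OF Hausdorff continuous_range continuous_map_id])
  moreover have "{\<gamma> \<in> topspace T. rng \<gamma> = id \<gamma>} = unit_space G"
  proof (intro equalityI subsetI)
    fix \<gamma> assume "\<gamma> \<in> {\<gamma> \<in> topspace T. rng \<gamma> = id \<gamma>}"
    then show "\<gamma> \<in> unit_space G" using range_in[of \<gamma>] by simp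
  next
    fix \<gamma> assume "\<gamma> \<in> unit_space G"
    then show "\<gamma> \<in> {\<gamma> \<in> topspace T. rng \<gamma> = id \<gamma>}" using unit_in_arrows by simp
  qed
  ultimately show ?thesis by simp
qed

text \<open>Having no arrow of K with both ends in V is inherited by subsets of V. Hence the
  shrinkings for the members of a finite cover of K can be performed in succession, with a last one
  to reach a compact open set.\<close>

lemma effective_shrink:
  assumes eff: "effective_groupoid G"
    and K: "compactin T K" "K \<subseteq> arrows G - unit_space G"
    and W: "openin T W" "W \<subseteq> unit_space G" "W \<noteq> {}"
  obtains V where "openin T V" "compactin T V" "V \<noteq> {}" "V \<subseteq> W"
    "\<And>\<gamma>. \<gamma> \<in> K \<Longrightarrow> \<not> (rng \<gamma> \<in> V \<and> src \<gamma> \<in> V)"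
proof -
  obtain \<F> where \<F>: "finite \<F>" "\<And>B. B \<in> \<F> \<Longrightarrow> compact_open_bisection G B"
    "\<And>B. B \<in> \<F> \<Longrightarrow> B \<subseteq> arrows G - unit_space G" "K \<subseteq> \<Union>\<F>"
    using finite_bisection_cover[OF K(1) openin_diff[OF openin_arrows closedin_units] K(2)] by blast
  have "\<exists>V. openin T V \<and> V \<noteq> {} \<and> V \<subseteq> W \<and> (\<forall>\<gamma>\<in>\<Union>\<F>. \<not> (rng \<gamma> \<in> V \<and> src \<gamma> \<in> V))"
    using \<F>(1-3)
  proof (induction \<F>)
    case empty
    then show ?case using W by (intro exI[of _ W]) simp
  next
    case (insert B \<F>)
    have "\<exists>V. openin T V \<and> V \<noteq> {} \<and> V \<subseteq> W \<and> (\<forall>\<gamma>\<in>\<Union>\<F>. \<not> (rng \<gamma> \<in> V \<and> src \<gamma> \<in> V))"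
      by (intro insert.IH insert.prems insertI2)
    then obtain V where V: "openin T V" "V \<noteq> {}" "V \<subseteq> W"
      "\<forall>\<gamma>\<in>\<Union>\<F>. \<not> (rng \<gamma> \<in> V \<and> src \<gamma> \<in> V)" by blast
    have "V \<subseteq> unit_space G" using V(3) W(2) by blast
    from effective_shrink_bisection[OF eff insert.prems[OF insertI1] V(1) this V(2)]
    obtain V' where V': "openin T V'" "V' \<noteq> {}" "V' \<subseteq> V"
      "\<And>\<gamma>. \<gamma> \<in> B \<Longrightarrow> \<not> (rng \<gamma> \<in> V' \<and> src \<gamma> \<in> V')" by blast
    have "\<forall>\<gamma>\<in>\<Union>(insert B \<F>). \<not> (rng \<gamma> \<in> V' \<and> src \<gamma> \<in> V')" using V(4) V'(3,4) by blast
    moreover have "V' \<subseteq> W" using V(3) V'(3) by blast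
    ultimately show ?case using V'(1,2) by blast
  qed
  then obtain V where V: "openin T V" "V \<noteq> {}" "V \<subseteq> W"
    "\<forall>\<gamma>\<in>\<Union>\<F>. \<not> (rng \<gamma> \<in> V \<and> src \<gamma> \<in> V)" by blast
  have "V \<subseteq> unit_space G" using V(3) W(2) by blast
  from unit_compact_open_subset[OF V(1) this V(2)]
  obtain V' where V': "openin T V'" "compactin T V'" "V' \<noteq> {}" "V' \<subseteq> V" by blast
  have "\<not> (rng \<gamma> \<in> V' \<and> src \<gamma> \<in> V')" if "\<gamma> \<in> K" for \<gamma>
    using that V(4) V'(4) \<F>(4) by blast
  then show thesis using that[of V'] V' V(3) by blast
qed

text \<open>
  Convolution with the indicator of an inverse bisection moves a point of the support of \<open>a\<close> into the
  unit space.  Effectiveness then provides a corner in which only the unit part survives.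
\<close>

lemma indicator_in_principal_ideal:
  fixes a :: "'g \<Rightarrow> 'k::field"
  assumes eff: "effective_groupoid G" and a: "a \<in> SA" "a \<noteq> (\<lambda>_. 0)"
  obtains x y V where "x \<in> SA" "y \<in> SA" "openin T V" "compactin T V" "V \<subseteq> unit_space G" "V \<noteq> {}"
    "x \<star> a \<star> y = indicator V"
proof -
  obtain \<gamma>0 where \<gamma>0: "a \<gamma>0 \<noteq> 0" using a(2) by blast
  then have \<gamma>0a: "\<gamma>0 \<in> arrows G" using SA_arrow[OF a(1)] by blast
  define c where "c = a \<gamma>0"
  obtain N where N: "openin T N" "\<gamma>0 \<in> N" "\<And>\<gamma>. \<gamma> \<in> N \<Longrightarrow> a \<gamma> = c"
    unfolding c_def using SA_nhd[OF a(1) \<gamma>0a] by blast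
  obtain B where B: "compact_open_bisection G B" "\<gamma>0 \<in> B" "B \<subseteq> N"
    using ample[OF N(1,2)] by blast
  note Bsub = cob_subset[OF B(1)]
  define b where "b = a \<star> indicator (iv ` B)"
  have ind: "(indicator (iv ` B) :: 'g \<Rightarrow> 'k) \<in> SA"
    by (intro indicator_SA openin_inverse_image compactin_inverse_image cob_openin cob_compact B(1))
  have b: "b \<in> SA" unfolding b_def by (rule conv_SA[OF a(1) ind])
  \<comment> \<open>The only arrow of \<open>iv\<close> B\<open>with source\<close>rng
    \<gamma>\<open>is\<close>iv \<gamma>\<open>, so b reads off the value of a at \<gamma>. Thus b
    is constantly c on the whole open set\<close>rng \<open>B\<close> of units.\<close>
  have bc: "b (rng \<gamma>) = c" if \<gamma>: "\<gamma> \<in> B" for \<gamma>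
  proof -
    have \<gamma>a: "\<gamma> \<in> arrows G" using \<gamma> Bsub by blast
    have "b (rng \<gamma>) = a (rng \<gamma> \<cdot> iv (iv \<gamma>)) * indicator (iv ` B) (iv \<gamma>)"
      unfolding b_def
    proof (rule conv_eq_right)
      fix \<beta> assume "(indicator (iv ` B) \<beta> :: 'k) \<noteq> 0" and eq: "src \<beta> = src (iv \<gamma>)"
      then obtain \<delta> where \<delta>: "\<delta> \<in> B" "\<beta> = iv \<delta>" by (auto simp: indicator_def split: if_splits)
      then have "\<delta> \<in> arrows G" using Bsub by blast
      then have "rng \<delta> = rng \<gamma>" using eq \<delta>(2) \<gamma>a by simp
      then show "\<beta> = iv \<gamma>" using inj_onD[OF cob_inj_range[OF B(1)] _ \<delta>(1) \<gamma>] \<delta>(2) by blast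
    qed (use \<gamma>a in auto)
    also have "\<dots> = a \<gamma>" using \<gamma> \<gamma>a by simp
    also have "\<dots> = c" using N(3) B(3) \<gamma> by blast
    finally show ?thesis .
  qed
  let ?K = "(arrows G - unit_space G) \<inter> {\<gamma>. b \<gamma> \<noteq> 0}"
  have "closedin T (arrows G - unit_space G)"
    using closedin_diff[OF closedin_topspace openin_units] by simp
  then have K: "compactin T ?K" using closed_Int_compactin SA_compact[OF b] by blast
  let ?W = "rng ` B"
  have W: "openin T ?W" "?W \<subseteq> unit_space G" "?W \<noteq> {}"
    using bisection_image_openin(1)[OF cob_bisection[OF B(1)] cob_openin[OF B(1)]] Bsub range_in B(2)
    by blast+
  obtain V where V: "openin T V" "compactin T V" "V \<noteq> {}" "V \<subseteq> ?W"
    "\<And>\<gamma>. \<gamma> \<in> ?K \<Longrightarrow> \<not> (rng \<gamma> \<in> V \<and> src \<gamma> \<in> V)"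
    using effective_shrink[OF eff K _ W] by blast
  have Vu: "V \<subseteq> unit_space G" using V(4) W(2) by blast
  have indV: "(indicator V :: 'g \<Rightarrow> 'k) \<in> SA" by (intro indicator_SA V)
  \<comment> \<open>The right factor does two jobs: it restricts sources to V and divides by
    c.\<close>
  define v where "v = (\<lambda>\<gamma>. inverse c * indicator V \<gamma> :: 'k)"
  have v: "v \<in> SA" unfolding v_def by (rule SA_map[OF indV]) simp
  have "indicator V \<star> b \<star> v = indicator V"
  proof
    fix \<gamma>
    have sub: "{\<beta>. v \<beta> \<noteq> 0} \<subseteq> V" by (auto simp: v_def indicator_def)
    show "(indicator V \<star> b \<star> v) \<gamma> = indicator V \<gamma>"
    proof (cases "\<gamma> \<in> arrows G")
      case False
      then have "\<gamma> \<notin> V" using Vu unit_in_arrows by blast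
      then show ?thesis using False by (simp add: conv_outside)
    next
      case True
      have "(indicator V \<star> b \<star> v) \<gamma> = (indicator V \<star> b) (\<gamma> \<cdot> iv (src \<gamma>)) * v (src \<gamma>)"
      proof (rule conv_eq_right)
        fix \<beta> assume "v \<beta> \<noteq> 0" "src \<beta> = src (src \<gamma>)"
        then have "\<beta> \<in> unit_space G" using sub Vu by blast
        then show "\<beta> = src \<gamma>" using \<open>src \<beta> = src (src \<gamma>)\<close> True by simp
      qed (use True in auto)
      also have "\<dots> = indicator V (rng \<gamma>) * b \<gamma> * v (src \<gamma>)"
        using True Vu by (simp add: conv_indicator_left)
      \<comment> \<open>On units of V the coefficient is c times its inverse. Off the units, V was
        chosen so that b vanishes on every arrow with both ends in V.\<close>
      also have "\<dots> = indicator V \<gamma>"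
      proof (cases "\<gamma> \<in> unit_space G")
        case unit: True
        show ?thesis
        proof (cases "\<gamma> \<in> V")
          case \<gamma>V: True
          then obtain \<delta> where \<delta>: "\<delta> \<in> B" "\<gamma> = rng \<delta>" using V(4) by blast
          have "b \<gamma> = c" unfolding \<delta>(2) by (rule bc[OF \<delta>(1)])
          then show ?thesis using \<gamma>V unit \<gamma>0 by (simp add: v_def c_def)
        qed (use unit in simp)
      next
        case False
        then have "\<gamma> \<notin> V" using Vu by blast
        moreover have "rng \<gamma> \<notin> V \<or> src \<gamma> \<notin> V \<or> b \<gamma> = 0" using V(5)[of \<gamma>] False True by blast
        ultimately show ?thesis by (auto simp: v_def)
      qed
      finally show ?thesis .
    qed
  qed
  moreover have "indicator V \<star> b \<star> v = indicator V \<star> a \<star> (indicator (iv ` B) \<star> v)"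
    by (simp add: b_def conv_assoc conv_SA indV a(1) ind v)
  ultimately show thesis
    using that[of "indicator V" "indicator (iv ` B) \<star> v" V] indV conv_SA[OF ind v] V(1-3) Vu by simp
qed

text \<open>Conjugation by the indicator of B moves a set of units along B. Applied to indicators in
  an ideal, it shows that the union of the corresponding sets is invariant.\<close>

lemma conv_bisection_conjugate:
  assumes B: "compact_open_bisection G B" and V: "V \<subseteq> unit_space G"
  shows "(indicator B \<star> indicator V \<star> indicator (iv ` B) :: 'g \<Rightarrow> 'k::field)
    = indicator (rng ` {\<gamma> \<in> B. src \<gamma> \<in> V})" (is "_ = indicator (rng ` ?C)")
proof -
  note Bsub = cob_subset[OF B]
  have eq: "(indicator B \<star> indicator V :: 'g \<Rightarrow> 'k) = indicator ?C"
  proof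
    fix \<gamma> show "(indicator B \<star> indicator V) \<gamma> = (indicator ?C \<gamma> :: 'k)"
    proof (cases "\<gamma> \<in> arrows G")
      case True
      then show ?thesis using V by (simp add: conv_indicator_right indicator_def)
    next
      case False
      then have "\<gamma> \<notin> ?C" using Bsub by blast
      then show ?thesis using False by (simp add: conv_outside)
    qed
  qed
  have supp: "\<gamma> \<in> ?C" if "(indicator ?C \<gamma> :: 'k) \<noteq> 0" for \<gamma>
    using that by (metis indicator_simps(2))
  have "(indicator ?C \<star> indicator (iv ` B)) \<gamma> = (indicator (rng ` ?C) \<gamma> :: 'k)" for \<gamma>
  proof (cases "\<gamma> \<in> arrows G \<and> rng \<gamma> \<in> rng ` ?C")
    case False
    have "\<gamma> \<notin> rng ` ?C"
    proof
      assume "\<gamma> \<in> rng ` ?C"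
      then obtain \<delta> where \<delta>: "\<delta> \<in> ?C" "\<gamma> = rng \<delta>" by blast
      then have "\<delta> \<in> arrows G" using Bsub by blast
      then show False using False \<delta> by auto
    qed
    moreover have "(indicator ?C \<star> indicator (iv ` B)) \<gamma> = (0 :: 'k)"
      using False conv_outside conv_off_bisection[where B = ?C, OF supp] by blast
    ultimately show ?thesis by simp
  next
    case True
    then obtain \<alpha> where \<alpha>: "\<alpha> \<in> ?C" "rng \<alpha> = rng \<gamma>" by (metis (lifting) imageE)
    then have \<alpha>a: "\<alpha> \<in> arrows G" "\<alpha> \<in> B" using Bsub by blast+
    have "(indicator ?C \<star> indicator (iv ` B)) \<gamma> = (indicator ?C \<alpha> * indicator (iv ` B) (iv \<alpha> \<cdot> \<gamma>) :: 'k)"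
    proof (rule conv_on_bisection[OF B])
      show "x \<in> B" if "(indicator ?C x :: 'k) \<noteq> 0" for x using supp[OF that] by blast
    qed (use True \<alpha> \<alpha>a in auto)
    also have "\<dots> = indicator (iv ` B) (iv \<alpha> \<cdot> \<gamma>)" using \<alpha>(1) by simp
    \<comment> \<open>If \<open>iv \<alpha> \<cdot> \<gamma>\<close> is the inverse of some \<beta>
      in B, then \<beta> and \<alpha> share their source and coincide, so \<gamma> is the unit
      \<open>\<alpha> \<cdot> iv \<alpha>\<close>.\<close>
    also have "iv \<alpha> \<cdot> \<gamma> \<in> iv ` B \<longleftrightarrow> \<gamma> \<in> rng ` ?C"
    proof
      assume "iv \<alpha> \<cdot> \<gamma> \<in> iv ` B"
      then obtain \<beta> where \<beta>: "\<beta> \<in> B" "iv \<alpha> \<cdot> \<gamma> = iv \<beta>" by blast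
      then have \<beta>a: "\<beta> \<in> arrows G" using Bsub by blast
      have "src \<beta> = rng (iv \<alpha> \<cdot> \<gamma>)" using \<beta>(2) \<beta>a by simp
      also have "\<dots> = src \<alpha>" using \<alpha>(2) \<alpha>a True by simp
      finally have "\<beta> = \<alpha>" using inj_onD[OF cob_inj_source[OF B] _ \<beta>(1) \<alpha>a(2)] by blast
      then have "\<gamma> = \<alpha> \<cdot> iv \<alpha>" using \<beta>(2) cancel(2)[of \<alpha> \<gamma>] \<alpha>(2) \<alpha>a True by metis
      then show "\<gamma> \<in> rng ` ?C" using \<alpha>a \<alpha>(1) by simp
    next
      assume "\<gamma> \<in> rng ` ?C"
      then obtain \<delta> where "\<delta> \<in> ?C" "\<gamma> = rng \<delta>" by blast
      moreover have "\<delta> \<in> arrows G" using \<open>\<delta> \<in> ?C\<close> Bsub by blast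
      ultimately have "\<gamma> = rng \<alpha>" using \<alpha>(2) by simp
      then have "iv \<alpha> \<cdot> \<gamma> = iv \<alpha>" using \<alpha>a source_comp_right[of "iv \<alpha>"] by simp
      then show "iv \<alpha> \<cdot> \<gamma> \<in> iv ` B" using \<alpha>a by simp
    qed
    then have "(indicator (iv ` B) (iv \<alpha> \<cdot> \<gamma>) :: 'k) = indicator (rng ` ?C) \<gamma>"
      by (simp add: indicator_def)
    finally show ?thesis .
  qed
  then show ?thesis unfolding eq by blast
qed

section \<open>Simplicity\<close>

lemma two_sided_idealD:
  fixes I :: "('g \<Rightarrow> 'k::field) set"
  assumes "two_sided_ideal I (steinberg_algebra G)"
  shows "I \<subseteq> SA" "(\<lambda>_. 0) \<in> I" "\<And>f g. f \<in> I \<Longrightarrow> g \<in> I \<Longrightarrow> (\<lambda>x. f x + g x) \<in> I"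
    "\<And>f g. f \<in> I \<Longrightarrow> g \<in> SA \<Longrightarrow> f \<star> g \<in> I" "\<And>f g. f \<in> SA \<Longrightarrow> g \<in> I \<Longrightarrow> f \<star> g \<in> I"
proof -
  interpret additive_subgroup I "steinberg_algebra G" using assms by (simp add: two_sided_ideal_def)
  show "I \<subseteq> SA" "(\<lambda>_. 0) \<in> I" "\<And>f g. f \<in> I \<Longrightarrow> g \<in> I \<Longrightarrow> (\<lambda>x. f x + g x) \<in> I"
    using a_subset zero_closed a_closed by simp_all
  show "\<And>f g. f \<in> I \<Longrightarrow> g \<in> SA \<Longrightarrow> f \<star> g \<in> I" "\<And>f g. f \<in> SA \<Longrightarrow> g \<in> I \<Longrightarrow> f \<star> g \<in> I"
    using assms by (simp_all add: two_sided_ideal_def)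
qed

text \<open>Inclusion and exclusion: the correction term for the overlap is a convolution with a
  member of the ideal, so it stays in the ideal.\<close>

lemma ideal_indicator_Un:
  fixes I :: "('g \<Rightarrow> 'k::field) set"
  assumes I: "two_sided_ideal I (steinberg_algebra G)"
    and V: "V \<subseteq> unit_space G" "indicator V \<in> I" and W: "W \<subseteq> unit_space G" "indicator W \<in> I"
  shows "indicator (V \<union> W) \<in> I"
proof -
  note ideal = two_sided_idealD[OF I]
  have neg: "(\<lambda>x. - indicator W x :: 'k) \<in> SA"
    using SA_map[OF subsetD[OF ideal(1) W(2)], of uminus] by simp
  have "(\<lambda>x. (indicator W x + (indicator V \<star> (\<lambda>x. - indicator W x)) x)) \<in> I"
    by (intro ideal(3,4) V W neg)
  then have "(\<lambda>x. indicator V x + (indicator W x + (indicator V \<star> (\<lambda>x. - indicator W x)) x)) \<in> I"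
    by (rule ideal(3)[OF V(2)])
  moreover have "(indicator V \<star> (\<lambda>x. - indicator W x)) x = - (indicator (V \<inter> W) x :: 'k)" for x
  proof (cases "x \<in> arrows G")
    case True
    have "x \<in> V \<inter> W \<longleftrightarrow> rng x \<in> V \<and> x \<in> W" using W(1) by auto
    then show ?thesis using True V(1) by (simp add: conv_indicator_left indicator_def)
  next
    case False
    then have "x \<notin> V \<inter> W" using V(1) unit_in_arrows by blast
    then show ?thesis using False by (simp add: conv_outside)
  qed
  moreover have "(\<lambda>x. indicator V x + (indicator W x + - indicator (V \<inter> W) x))
      = (indicator (V \<union> W) :: 'g \<Rightarrow> 'k)"
    by (auto simp: indicator_def)
  ultimately show ?thesis by simp
qed

lemma minimal_effective_simple:
  fixes I :: "('g \<Rightarrow> 'k::field) set"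
  assumes eff: "effective_groupoid G" and min: "minimal_groupoid G"
    and I: "two_sided_ideal I (steinberg_algebra G)" and nz: "I \<noteq> {\<lambda>_. 0}"
  shows "I = SA"
proof -
  note ideal = two_sided_idealD[OF I]
  \<comment> \<open>The union of these sets measures how much of the unit space the ideal reaches.
    It is open by construction, and minimality applies once it is nonempty and invariant.\<close>
  let ?S = "{V. openin T V \<and> V \<subseteq> unit_space G \<and> (indicator V :: 'g \<Rightarrow> 'k) \<in> I}"
  let ?U = "\<Union>?S"
  obtain a where a: "a \<in> I" "a \<noteq> (\<lambda>_. 0)" using nz ideal(2) by blast
  then have "a \<in> SA" using ideal(1) by blast
  then obtain x y V0 where V0: "x \<in> SA" "y \<in> SA" "openin T V0" "compactin T V0"
    "V0 \<subseteq> unit_space G" "V0 \<noteq> {}" "x \<star> a \<star> y = indicator V0"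
    using indicator_in_principal_ideal[OF eff _ a(2)] by metis
  have "(indicator V0 :: 'g \<Rightarrow> 'k) \<in> I" using ideal(4)[OF ideal(5)[OF V0(1) a(1)] V0(2)] V0(7) by simp
  then have ne: "?U \<noteq> {}" using V0(3,5,6) by blast
  have inv1: "rng \<gamma> \<in> ?U" if \<gamma>: "\<gamma> \<in> arrows G" "src \<gamma> \<in> ?U" for \<gamma>
  proof -
    from \<gamma>(2) obtain V where V: "openin T V" "V \<subseteq> unit_space G" "(indicator V :: 'g \<Rightarrow> 'k) \<in> I" "src \<gamma> \<in> V"
      by blast
    obtain B where B: "compact_open_bisection G B" "\<gamma> \<in> B" using ample[OF openin_arrows \<gamma>(1)] by blast
    let ?C = "{\<gamma> \<in> B. src \<gamma> \<in> V}"
    have C: "?C = B \<inter> {\<gamma> \<in> arrows G. src \<gamma> \<in> V}" using cob_subset[OF B(1)] by blast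
    have "openin T ?C" unfolding C using cob_openin[OF B(1)] openin_source_vimage[OF V(1)] by blast
    moreover have "?C \<subseteq> B" by blast
    ultimately have "openin T (rng ` ?C)"
      using bisection_image_openin(1)[OF cob_bisection[OF B(1)]] by blast
    moreover have "rng ` ?C \<subseteq> unit_space G" using cob_subset[OF B(1)] range_in by blast
    moreover have "(indicator B :: 'g \<Rightarrow> 'k) \<in> SA" "(indicator (iv ` B) :: 'g \<Rightarrow> 'k) \<in> SA"
      by (intro indicator_SA openin_inverse_image compactin_inverse_image cob_openin cob_compact B(1))+
    then have "(indicator (rng ` ?C) :: 'g \<Rightarrow> 'k) \<in> I"
      unfolding conv_bisection_conjugate[OF B(1) V(2), symmetric] by (intro ideal(4,5) V(3))
    moreover have "rng \<gamma> \<in> rng ` ?C" using B(2) V(4) by blast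
    ultimately show ?thesis by blast
  qed
  have "invariant_units G ?U"
    unfolding invariant_units_def
  proof (intro conjI ballI iffI)
    fix \<gamma> assume \<gamma>: "\<gamma> \<in> arrows G" "rng \<gamma> \<in> ?U"
    show "src \<gamma> \<in> ?U" using inv1[of "iv \<gamma>"] \<gamma> by simp
  qed (use inv1 in blast)+
  moreover have "openin (unit_top G) ?U" unfolding openin_unit_top by blast
  ultimately have U: "?U = unit_space G" using min ne unfolding minimal_groupoid_def by blast
  have "f \<in> I" if f: "f \<in> SA" for f
  proof -
    \<comment> \<open>A left unit for f only has to be 1 on the ranges of its support; these form a
      compact set, so finitely many members of \<open>?S\<close> cover it.\<close>
    let ?R = "rng ` {x. f x \<noteq> 0}"
    have "compactin T ?R" by (rule image_compactin[OF SA_compact[OF f] continuous_range])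
    moreover have "?R \<subseteq> ?U" unfolding U using SA_arrow[OF f] range_in by blast
    ultimately obtain \<F> where \<F>: "finite \<F>" "\<F> \<subseteq> ?S" "?R \<subseteq> \<Union>\<F>"
      using compactinD[of T ?R ?S] by auto
    have "\<Union>\<F> \<subseteq> unit_space G \<and> (indicator (\<Union>\<F>) :: 'g \<Rightarrow> 'k) \<in> I"
      using \<F>(1,2)
    proof (induction \<F>)
      case empty
      have "(indicator {} :: 'g \<Rightarrow> 'k) = (\<lambda>_. 0)" by auto
      then show ?case using ideal(2) by simp
    next
      case (insert V \<F>)
      then show ?case using ideal_indicator_Un[OF I, of V "\<Union>\<F>"] by simp
    qed
    then have W: "\<Union>\<F> \<subseteq> unit_space G" "(indicator (\<Union>\<F>) :: 'g \<Rightarrow> 'k) \<in> I" by auto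
    have "indicator (\<Union>\<F>) \<star> f = f"
    proof
      fix \<gamma> show "(indicator (\<Union>\<F>) \<star> f) \<gamma> = f \<gamma>"
      proof (cases "\<gamma> \<in> arrows G")
        case True
        have "f \<gamma> \<noteq> 0 \<Longrightarrow> rng \<gamma> \<in> \<Union>\<F>" using \<F>(3) by blast
        then show ?thesis using True W(1) by (cases "f \<gamma> = 0") (simp_all add: conv_indicator_left)
      next
        case False
        then have "f \<gamma> = 0" using SA_arrow[OF f] by blast
        then show ?thesis using False by (simp add: conv_outside)
      qed
    qed
    then show ?thesis using ideal(4)[OF W(2) f] by simp
  qed
  then show ?thesis using ideal(1) by blast
qed

end

theorem theorem3p2:
  fixes G :: "'g groupoid_data"
  assumes "ample_Hausdorff_groupoid G"
    and "minimal_groupoid G"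
    and "effective_groupoid G"
  shows "algebraically_purely_infinite_simple (steinberg_algebra G :: ('g \<Rightarrow> 'k::field) ring) \<longleftrightarrow>
    (\<forall>U. openin (unit_top G) U \<and> compactin (unit_top G) U \<and> U \<noteq> {} \<longrightarrow>
      infinite_idempotent (steinberg_algebra G :: ('g \<Rightarrow> 'k) ring) (indicator U))"
proof -
  interpret ample_Hausdorff_groupoid G by fact
  let ?A = "steinberg_algebra G :: ('g \<Rightarrow> 'k) ring"
  interpret A: nonunital_ring ?A by (rule nonunital_ring_steinberg)
  show ?thesis
  proof (intro iffI allI impI)
    fix U assume pis: "algebraically_purely_infinite_simple ?A"
      and "openin (unit_top G) U \<and> compactin (unit_top G) U \<and> U \<noteq> {}"
    then have U: "openin T U" "compactin T U" "U \<subseteq> unit_space G" "U \<noteq> {}" by auto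
    let ?e = "indicator U :: 'g \<Rightarrow> 'k"
    have e: "idempotent ?A ?e"
      using U by (simp add: idempotent_def indicator_SA conv_indicators)
    then have eA: "?e \<in> carrier ?A" and ee: "?e \<otimes>\<^bsub>?A\<^esub> ?e = ?e" by (simp_all add: idempotent_def)
    \<comment> \<open>The right ideal generated by the indicator of U. It contains that indicator,
      which is nonzero because U is nonempty, so pure infiniteness applies to it.\<close>
    let ?I = "{f \<in> carrier ?A. ?e \<otimes>\<^bsub>?A\<^esub> f = f}"
    have "?e \<noteq> \<zero>\<^bsub>?A\<^esub>"
      using U(4) unfolding steinberg_simps by (metis all_not_in_conv indicator_simps(1) zero_neq_one)
    moreover have "?e \<in> ?I" using eA ee by blast
    ultimately have "?I \<noteq> {\<zero>\<^bsub>?A\<^esub>}" by blast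
    then obtain p where "p \<in> ?I" "infinite_idempotent ?A p"
      using pis A.right_ideal_fixed_by_idempotent[OF eA]
      unfolding algebraically_purely_infinite_simple_def by blast
    then show "infinite_idempotent ?A ?e"
      using A.infinite_idempotent_above[OF e] by blast
  next
    assume inf: "\<forall>U. openin (unit_top G) U \<and> compactin (unit_top G) U \<and> U \<noteq> {} \<longrightarrow>
      infinite_idempotent ?A (indicator U)"
    show "algebraically_purely_infinite_simple ?A"
      unfolding algebraically_purely_infinite_simple_def
    proof (intro conjI allI impI)
      fix I assume "two_sided_ideal I ?A"
      then show "I = {\<zero>\<^bsub>?A\<^esub>} \<or> I = carrier ?A"
        using minimal_effective_simple[OF assms(3,2)] by auto
    next
      fix I assume "right_ideal I ?A \<and> I \<noteq> {\<zero>\<^bsub>?A\<^esub>}"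
      then have I: "right_ideal I ?A" "I \<noteq> {\<zero>\<^bsub>?A\<^esub>}" by auto
      interpret I: additive_subgroup I ?A using I(1) by (simp add: right_ideal_def)
      obtain a where a: "a \<in> I" "a \<noteq> (\<lambda>_. 0)" using I(2) I.zero_closed by auto
      obtain x y V where V: "x \<in> SA" "y \<in> SA" "openin T V" "compactin T V" "V \<subseteq> unit_space G" "V \<noteq> {}"
        "x \<star> a \<star> y = indicator V"
        using indicator_in_principal_ideal[OF assms(3) I.a_Hcarr[OF a(1)] a(2)] by metis
      have "infinite_idempotent ?A (indicator V)" using inf V by simp
      then have "infinite_idempotent ?A (x \<otimes>\<^bsub>?A\<^esub> a \<otimes>\<^bsub>?A\<^esub> y)" using V(7) by simp
      then show "\<exists>p\<in>I. infinite_idempotent ?A p"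
        using A.right_ideal_infinite_idempotent[OF I(1) a(1) V(1,2)] by blast
    qed
  qed
qed

end
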